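(* Let $f\in\mathbb Q[Z]$ be monic and irreducible of degree $n$, let $x_1,\dots,x_n$ be a numbering of its zeros in a splitting field $L=\mathbb Q(x_1,\dots,x_n)$, and let $\gamma$ be a rational integer such that $\gamma x_j$ is an algebraic integer for all $j$. Let $d(f)=\prod_{1\le r<s\le n}(x_r-x_s)^2$. Put $K_i=\mathbb Q(x_1,\dots,x_i)$ ($K_0=\mathbb Q$), let $f_i$ be the minimal polynomial of $x_i$ over $K_{i-1}$, $d_i=\deg f_i$, write $f_i=T_i^{d_i}+\sum_{k_i=1}^{d_i}b_{i,k_i}T_i^{d_i-k_i}$, expand uniquely $b_{i,k_i}=\sum_{k_1=1}^{d_1}\cdots\sum_{k_{i-1}=1}^{d_{i-1}} b_{i,k_1,\dots,k_i}x_1^{d_1-k_1}\cdots x_{i-1}^{d_{i-1}-k_{i-1}}$ with $b_{i,k_1,\dots,k_i}\in\mathbb Q$, and set $\widehat{f_i}=T_i^{d_i}+\sum_{k_1=1}^{d_1}\cdots\sum_{k_i=1}^{d_i} b_{i,k_1,\dots,k_i}T_1^{d_1-k_1}\cdots T_i^{d_i-k_i}\in\mathbb Q[T_1,\dots,T_i]$. Then for each $i=1,\dots,n$ the rational integer $$\Delta_i=\gamma^{\,n(n-1)\lceil i/2\rceil+d_i}\,d(f)^{\lceil i/2\rceil}$$ has the property that $\Delta_i\widehat{f_i}\in\mathbb Z[T_1,\dots,T_i]$.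
   Context: $\lceil\cdot\rceil$ denotes the ceiling function. *)

theory Defs
  imports
    Complex_Main
    "HOL-Library.FuncSet"
    "HOL-Library.Poly_Mapping"
    "HOL-Computational_Algebra.Polynomial"
begin

definition is_subfield :: "'a::field set \<Rightarrow> bool" where
  "is_subfield K \<longleftrightarrow> 0 \<in> K \<and> 1 \<in> K \<and>
     (\<forall>a\<in>K. \<forall>b\<in>K. a + b \<in> K \<and> a * b \<in> K) \<and> (\<forall>a\<in>K. - a \<in> K \<and> inverse a \<in> K)"

text \<open>In characteristic 0 every subfield contains the rationals, so \<open>gen_field S\<close> is \<open>\<rat>(S)\<close>.\<close>

definition gen_field :: "'a::field_char_0 set \<Rightarrow> 'a set" where
  "gen_field S = is_subfield hull S"

definition minimal_poly_over :: "'a::field set \<Rightarrow> 'a \<Rightarrow> 'a poly" where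
  "minimal_poly_over K a = (THE p. lead_coeff p = 1 \<and> (\<forall>m. coeff p m \<in> K) \<and> poly p a = 0 \<and>
     (\<forall>q. q \<noteq> 0 \<and> (\<forall>m. coeff q m \<in> K) \<and> poly q a = 0 \<longrightarrow> degree p \<le> degree q))"

definition tower_field :: "(nat \<Rightarrow> 'a::field_char_0) \<Rightarrow> nat \<Rightarrow> 'a set" where
  "tower_field x i = gen_field (x ` {1..i})"

definition tower_poly :: "(nat \<Rightarrow> 'a::field_char_0) \<Rightarrow> nat \<Rightarrow> 'a poly" where
  "tower_poly x i = minimal_poly_over (tower_field x (i - 1)) (x i)"

definition tower_deg :: "(nat \<Rightarrow> 'a::field_char_0) \<Rightarrow> nat \<Rightarrow> nat" where
  "tower_deg x i = degree (tower_poly x i)"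

definition tower_indices :: "(nat \<Rightarrow> 'a::field_char_0) \<Rightarrow> nat \<Rightarrow> (nat \<Rightarrow> nat) set" where
  "tower_indices x i = (\<Pi>\<^sub>E j\<in>{1..i}. {1..tower_deg x j})"

text \<open>
  The index tuple \<open>(k\<^sub>1, \<dots>, k\<^sub>i)\<close> is the function \<open>k(i := m)\<close> with \<open>k \<in> tower_indices x (i - 1)\<close>
  and \<open>m = k\<^sub>i\<close>. The condition \<open>b \<in> extensional _\<close> only fixes the values of \<open>b\<close> at
  non-indices, so that \<open>b\<close> is determined as a function.
\<close>

definition tower_coeff :: "(nat \<Rightarrow> 'a::field_char_0) \<Rightarrow> nat \<Rightarrow> (nat \<Rightarrow> nat) \<Rightarrow> rat" where
  "tower_coeff x i = (THE b. b \<in> extensional (tower_indices x i) \<and>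
     (\<forall>m\<in>{1..tower_deg x i}.
        coeff (tower_poly x i) (tower_deg x i - m) =
        (\<Sum>k\<in>tower_indices x (i - 1).
           of_rat (b (k(i := m))) * (\<Prod>j=1..i - 1. x j ^ (tower_deg x j - k j)))))"

text \<open>
  Polynomials in \<open>T\<^sub>1, T\<^sub>2, \<dots>\<close> are finitely supported maps from monomials (exponent vectors) to
  coefficients, with the convolution product of \<^theory>\<open>HOL-Library.Poly_Mapping\<close>.
\<close>

type_synonym 'c mpol = "(nat \<Rightarrow>\<^sub>0 nat) \<Rightarrow>\<^sub>0 'c"

definition mp_const :: "'c::comm_ring_1 \<Rightarrow> 'c mpol" where
  "mp_const c = Poly_Mapping.single 0 c"

definition mp_var :: "nat \<Rightarrow> 'c::comm_ring_1 mpol" where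
  "mp_var j = Poly_Mapping.single (Poly_Mapping.single j 1) 1"

definition tower_hat :: "(nat \<Rightarrow> 'a::field_char_0) \<Rightarrow> nat \<Rightarrow> rat mpol" where
  "tower_hat x i = mp_var i ^ tower_deg x i +
     (\<Sum>k\<in>tower_indices x i. mp_const (tower_coeff x i k) * (\<Prod>j=1..i. mp_var j ^ (tower_deg x j - k j)))"

text \<open>\<open>int_mpols i\<close> is \<open>\<int>[T\<^sub>1, \<dots>, T\<^sub>i]\<close> as a subset of the polynomials over the rationals.\<close>

definition int_mpols :: "nat \<Rightarrow> rat mpol set" where
  "int_mpols i = {p. (\<forall>t. Poly_Mapping.lookup p t \<in> \<int>) \<and>
                     (\<forall>t\<in>Poly_Mapping.keys p. Poly_Mapping.keys t \<subseteq> {1..i})}"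

definition root_disc :: "nat \<Rightarrow> (nat \<Rightarrow> 'a::field) \<Rightarrow> 'a" where
  "root_disc n x = (\<Prod>(r, s)\<in>{(r, s). 1 \<le> r \<and> r < s \<and> s \<le> n}. (x r - x s)\<^sup>2)"

end

theory Submission
  imports Defs "Jordan_Normal_Form.Char_Poly"
begin

text \<open>
  Let \<open>y\<^sub>j = \<gamma> x\<^sub>j\<close> and let \<open>V\<^sub>j\<close> be the Vandermonde product of \<open>y\<^sub>j, \<dots>, y\<^sub>n\<close>. An element of \<open>K\<^sub>j\<close> is
  \<open>B(x\<^sub>j)\<close> with \<open>B\<close> a polynomial over \<open>K\<^sub>j\<^sub>-\<^sub>1\<close> of degree less than \<open>d\<^sub>j\<close>, and \<open>B\<close> is recovered from the
  conjugates \<open>B(x\<^sub>r)\<close>, where \<open>x\<^sub>r\<close> runs over the zeros of \<open>f\<^sub>j\<close>, by Lagrange interpolation. The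
  denominators are products of differences \<open>y\<^sub>r - y\<^sub>s\<close> with \<open>s \<ge> j\<close>, so if \<open>V\<^sub>j\<^sub>+\<^sub>1 B(x\<^sub>j)\<close> and its conjugates
  are integral, then \<open>V\<^sub>j\<close> clears the denominators of the coefficients of \<open>B\<close>. Going down the tower
  from the integral multiples \<open>\<gamma>\<^bsup>d\<^sub>i\<^esup> b\<close> of the coefficients \<open>b\<close> of \<open>f\<^sub>i\<close>, the rational coefficients acquire
  at most the denominator \<open>V\<^sub>1\<close>, and \<open>V\<^sub>1\<^sup>2 = \<gamma>\<^bsup>n(n-1)\<^esup> d(f)\<close>.
\<close>

subsection \<open>The ring of algebraic integers\<close>

text \<open>The subgroup generated by \<open>V\<close>, for finite \<open>V\<close>. Coefficients
  are total functions, of which only the values on \<open>V\<close> count.\<close>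

definition int_span :: "'a::comm_ring_1 set \<Rightarrow> 'a set" where
  "int_span V = range (\<lambda>c. \<Sum>v\<in>V. of_int (c v) * v)"

lemma int_span_base: "finite V \<Longrightarrow> v \<in> V \<Longrightarrow> v \<in> int_span V"
  unfolding int_span_def
  by (rule range_eqI[of _ _ "\<lambda>w. if w = v then 1 else 0"])
     (simp add: if_distrib[of of_int] if_distrib[of "\<lambda>c. c * _"] sum.delta cong: if_cong)

lemma int_span_zero: "0 \<in> int_span V"
  unfolding int_span_def by (rule range_eqI[of _ _ "\<lambda>_. 0"]) simp

lemma int_span_add: "a \<in> int_span V \<Longrightarrow> b \<in> int_span V \<Longrightarrow> a + b \<in> int_span V"
  unfolding int_span_def
proof (elim rangeE)
  fix c d
  assume "a = (\<Sum>v\<in>V. of_int (c v) * v)" "b = (\<Sum>v\<in>V. of_int (d v) * v)"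
  thus "a + b \<in> range (\<lambda>c. \<Sum>v\<in>V. of_int (c v) * v)"
    by (intro range_eqI[of _ _ "\<lambda>v. c v + d v"]) (simp add: sum.distrib ring_distribs)
qed

lemma int_span_scale: "a \<in> int_span V \<Longrightarrow> of_int k * a \<in> int_span V"
  unfolding int_span_def
proof (elim rangeE)
  fix c
  assume "a = (\<Sum>v\<in>V. of_int (c v) * v)"
  thus "of_int k * a \<in> range (\<lambda>c. \<Sum>v\<in>V. of_int (c v) * v)"
    by (intro range_eqI[of _ _ "\<lambda>v. k * c v"]) (simp add: sum_distrib_left mult.assoc)
qed

lemma int_span_sum: "(\<And>i. i \<in> I \<Longrightarrow> g i \<in> int_span V) \<Longrightarrow> sum g I \<in> int_span V"
  by (induction I rule: infinite_finite_induct) (auto intro: int_span_zero int_span_add)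

lemma mult_int_span:
  assumes "\<And>v. v \<in> V \<Longrightarrow> z * v \<in> int_span V" "a \<in> int_span V"
  shows "z * a \<in> int_span V"
proof -
  from assms(2) obtain c where c: "a = (\<Sum>v\<in>V. of_int (c v) * v)"
    by (auto simp: int_span_def)
  have "z * a = (\<Sum>v\<in>V. of_int (c v) * (z * v))"
    unfolding c by (simp add: sum_distrib_left mult_ac)
  also have "\<dots> \<in> int_span V"
    by (intro int_span_sum int_span_scale assms(1))
  finally show ?thesis .
qed

text \<open>The determinant trick: multiplication by \<open>z\<close> acts on the generators through
  an integer matrix, the generators form an eigenvector for \<open>z\<close> (nonzero because of
  \<open>u\<close>), and so \<open>z\<close> is a root of a monic integer characteristic
  polynomial.\<close>

lemma algebraic_int_if_int_span_stable:
  fixes z :: "'a::field_char_0"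
  assumes "finite V" "u \<in> V" "u \<noteq> 0" and stable: "\<And>v. v \<in> V \<Longrightarrow> z * v \<in> int_span V"
  shows "algebraic_int z"
proof -
  obtain e where e: "bij_betw e {0..<card V} V"
    using ex_bij_betw_nat_finite[OF \<open>finite V\<close>] by blast
  define N where "N = card V"
  have "\<forall>v\<in>V. \<exists>c. z * v = (\<Sum>w\<in>V. of_int (c w) * w)"
    using stable by (auto simp: int_span_def)
  then obtain c where c: "\<And>v. v \<in> V \<Longrightarrow> z * v = (\<Sum>w\<in>V. of_int (c v w) * w)"
    by metis
  define A where "A = mat N N (\<lambda>(i, j). c (e i) (e j))"
  define B :: "'a mat" where "B = map_mat of_int A"
  have A: "A \<in> carrier_mat N N" by (simp add: A_def)
  have B: "B \<in> carrier_mat N N" using A by (simp add: B_def)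
  obtain i0 where i0: "i0 < N" "e i0 = u"
    using e \<open>u \<in> V\<close> unfolding bij_betw_def N_def by (metis atLeastLessThan_iff imageE)
  have "eigenvector B (vec N e) z"
    unfolding eigenvector_def
  proof (intro conjI)
    show "vec N e \<in> carrier_vec (dim_row B)" using B by auto
    show "vec N e \<noteq> 0\<^sub>v (dim_row B)"
    proof
      assume "vec N e = 0\<^sub>v (dim_row B)"
      hence "vec N e $ i0 = 0\<^sub>v (dim_row B) $ i0" by simp
      thus False using i0 B \<open>u \<noteq> 0\<close> by auto
    qed
    show "B *\<^sub>v vec N e = z \<cdot>\<^sub>v vec N e"
    proof (rule eq_vecI)
      fix i assume "i < dim_vec (z \<cdot>\<^sub>v vec N e)"
      hence i: "i < N" by simp
      hence ei: "e i \<in> V" using e by (auto simp: bij_betw_def N_def)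
      have "(B *\<^sub>v vec N e) $ i = (\<Sum>j = 0..<N. of_int (c (e i) (e j)) * e j)"
        using i A B by (simp add: scalar_prod_def B_def A_def)
      also have "\<dots> = (\<Sum>w\<in>V. of_int (c (e i) w) * w)"
        by (rule sum.reindex_bij_betw) (use e in \<open>simp add: N_def\<close>)
      also have "\<dots> = z * e i" using c[OF ei] by simp
      finally show "(B *\<^sub>v vec N e) $ i = (z \<cdot>\<^sub>v vec N e) $ i" using i by simp
    qed (use B in auto)
  qed
  hence "poly (char_poly B) z = 0"
    using eigenvalue_root_char_poly[OF B] by (auto simp: eigenvalue_def)
  moreover have "char_poly B = map_poly of_int (char_poly A)"
    unfolding B_def by (rule of_int_hom.char_poly_hom[OF A])
  ultimately show ?thesis
    unfolding algebraic_int_altdef_ipoly using degree_monic_char_poly[OF A] by auto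
qed

lemma algebraic_int_power_reduce:
  fixes x :: "'a::field_char_0"
  assumes "algebraic_int x"
  obtains m c where "m > 0" "x ^ m = (\<Sum>a<m. of_int (c a) * x ^ a)"
proof -
  from assms obtain p where p: "poly (map_poly of_int p) x = 0" "lead_coeff p = 1"
    by (auto simp: algebraic_int_altdef_ipoly)
  let ?m = "degree p"
  have deg: "degree (map_poly of_int p :: 'a poly) = ?m" by simp
  have "0 = (\<Sum>a\<le>?m. of_int (coeff p a) * x ^ a)"
    using p(1) by (simp add: poly_altdef deg coeff_map_poly)
  also have "\<dots> = (\<Sum>a<?m. of_int (coeff p a) * x ^ a) + x ^ ?m"
    using p(2) by (simp flip: lessThan_Suc_atMost)
  finally have *: "x ^ ?m = (\<Sum>a<?m. of_int (- coeff p a) * x ^ a)"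
    by (simp add: sum_negf eq_neg_iff_add_eq_0 add.commute)
  \<comment> \<open>In degree 0 the relation would read 1 = 0. Positivity puts 1 among the
    generators used below for sums and products.\<close>
  have "?m > 0"
  proof (rule ccontr)
    assume "\<not> ?m > 0"
    thus False using * by simp
  qed
  thus ?thesis using * by (rule that[of ?m "\<lambda>a. - coeff p a"])
qed

text \<open>The monomials x^a y^b with a < m and b < n span a group stable under multiplication by
  \<open>x\<close> and by \<open>y\<close>, hence by their sum and product.\<close>

lemma algebraic_int_add_mult:
  fixes x y :: "'a::field_char_0"
  assumes "algebraic_int x" "algebraic_int y"
  shows "algebraic_int (x + y)" and "algebraic_int (x * y)"
proof -
  obtain m c where m: "m > 0" "x ^ m = (\<Sum>a<m. of_int (c a) * x ^ a)"
    using algebraic_int_power_reduce[OF assms(1)] .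
  obtain n d where n: "n > 0" "y ^ n = (\<Sum>b<n. of_int (d b) * y ^ b)"
    using algebraic_int_power_reduce[OF assms(2)] .
  define V where "V = (\<lambda>(a, b). x ^ a * y ^ b) ` ({..<m} \<times> {..<n})"
  have fin: "finite V" by (simp add: V_def)
  have VI: "x ^ a * y ^ b \<in> V" if "a < m" "b < n" for a b
    using that by (auto simp: V_def)
  have one: "1 \<in> V" using VI[of 0 0] m n by simp
  have x: "x * v \<in> int_span V" if "v \<in> V" for v
  proof -
    from that obtain a b where ab: "a < m" "b < n" "v = x ^ a * y ^ b" by (auto simp: V_def)
    show ?thesis
    proof (cases "Suc a < m")
      case True
      thus ?thesis using int_span_base[OF fin VI[of "Suc a" b]] ab by (simp add: mult_ac)
    next
      case False
      hence "m = Suc a" using ab by simp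
      hence "x * v = x ^ m * y ^ b" using ab by (simp add: mult_ac)
      also have "\<dots> = (\<Sum>a<m. of_int (c a) * (x ^ a * y ^ b))"
        unfolding m(2) sum_distrib_right by (simp add: mult_ac)
      also have "\<dots> \<in> int_span V"
        by (intro int_span_sum int_span_scale int_span_base fin VI) (use ab in auto)
      finally show ?thesis .
    qed
  qed
  have y: "y * v \<in> int_span V" if "v \<in> V" for v
  proof -
    from that obtain a b where ab: "a < m" "b < n" "v = x ^ a * y ^ b" by (auto simp: V_def)
    show ?thesis
    proof (cases "Suc b < n")
      case True
      thus ?thesis using int_span_base[OF fin VI[of a "Suc b"]] ab by (simp add: mult_ac)
    next
      case False
      hence "n = Suc b" using ab by simp
      hence "y * v = x ^ a * y ^ n" using ab by (simp add: mult_ac)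
      also have "\<dots> = (\<Sum>b<n. of_int (d b) * (x ^ a * y ^ b))"
        unfolding n(2) by (simp add: sum_distrib_left mult_ac)
      also have "\<dots> \<in> int_span V"
        by (intro int_span_sum int_span_scale int_span_base fin VI) (use ab in auto)
      finally show ?thesis .
    qed
  qed
  show "algebraic_int (x + y)"
    by (rule algebraic_int_if_int_span_stable[OF fin one])
       (auto simp: distrib_right intro: int_span_add x y)
  show "algebraic_int (x * y)"
    by (rule algebraic_int_if_int_span_stable[OF fin one])
       (auto simp: mult.assoc intro: mult_int_span x y)
qed

lemma algebraic_int_diff:
  "algebraic_int x \<Longrightarrow> algebraic_int y \<Longrightarrow> algebraic_int (x - y :: 'a::field_char_0)"
  using algebraic_int_add_mult(1)[of x "- y"] by simp

lemma algebraic_int_sum: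
  "(\<And>i. i \<in> I \<Longrightarrow> algebraic_int (g i :: 'a::field_char_0)) \<Longrightarrow> algebraic_int (sum g I)"
  by (induction I rule: infinite_finite_induct) (auto intro: algebraic_int_add_mult)

lemma algebraic_int_prod:
  "(\<And>i. i \<in> I \<Longrightarrow> algebraic_int (g i :: 'a::field_char_0)) \<Longrightarrow> algebraic_int (prod g I)"
  by (induction I rule: infinite_finite_induct) (auto intro: algebraic_int_add_mult)

lemma algebraic_int_power:
  "algebraic_int (a :: 'a::field_char_0) \<Longrightarrow> algebraic_int (a ^ k)"
  using algebraic_int_prod[of "{..<k}" "\<lambda>_. a"] by simp

text \<open>Takes integrality back from squares, in which the descent is carried out, to the numbers
  themselves.\<close>

lemma algebraic_int_power2D:
  assumes "algebraic_int ((a :: 'a::field_char_0)\<^sup>2)"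
  shows "algebraic_int a"
  by (rule algebraic_int_root[OF assms, where p = "monom 1 2"])
     (auto simp: poly_monom degree_monom_eq)

subsection \<open>Polynomials over a subfield\<close>

text \<open>\<open>K\<close> may be any set: it stands for subfields and, later, for the ring of
  algebraic integers.\<close>

definition poly_over :: "'a::comm_ring_1 set \<Rightarrow> 'a poly set" where
  "poly_over K = {p. \<forall>m. coeff p m \<in> K}"

lemma poly_overD: "p \<in> poly_over K \<Longrightarrow> coeff p m \<in> K"
  by (simp add: poly_over_def)

lemma poly_overI: "(\<And>m. coeff p m \<in> K) \<Longrightarrow> p \<in> poly_over K"
  by (simp add: poly_over_def)

lemma poly_over_mono: "K \<subseteq> L \<Longrightarrow> poly_over K \<subseteq> poly_over L"
  by (auto simp: poly_over_def)

context
  fixes K :: "'a::field_char_0 set"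
  assumes K: "is_subfield K"
begin

lemma subfield_zero: "0 \<in> K" and subfield_one: "1 \<in> K"
  and subfield_add: "a \<in> K \<Longrightarrow> b \<in> K \<Longrightarrow> a + b \<in> K"
  and subfield_mult: "a \<in> K \<Longrightarrow> b \<in> K \<Longrightarrow> a * b \<in> K"
  and subfield_uminus: "a \<in> K \<Longrightarrow> - a \<in> K"
  and subfield_inverse: "a \<in> K \<Longrightarrow> inverse a \<in> K"
  using K unfolding is_subfield_def by blast+

lemma subfield_diff: "a \<in> K \<Longrightarrow> b \<in> K \<Longrightarrow> a - b \<in> K"
  using subfield_add[of a "- b"] subfield_uminus[of b] by simp

lemma subfield_divide: "a \<in> K \<Longrightarrow> b \<in> K \<Longrightarrow> a / b \<in> K"
  by (simp add: divide_inverse subfield_mult subfield_inverse)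

lemma subfield_power: "a \<in> K \<Longrightarrow> a ^ k \<in> K"
  by (induction k) (auto intro: subfield_one subfield_mult)

lemma subfield_sum: "(\<And>i. i \<in> I \<Longrightarrow> g i \<in> K) \<Longrightarrow> sum g I \<in> K"
  by (induction I rule: infinite_finite_induct) (auto intro: subfield_zero subfield_add)

lemma subfield_prod: "(\<And>i. i \<in> I \<Longrightarrow> g i \<in> K) \<Longrightarrow> prod g I \<in> K"
  by (induction I rule: infinite_finite_induct) (auto intro: subfield_one subfield_mult)

lemma subfield_of_nat: "of_nat k \<in> K"
  by (induction k) (auto intro: subfield_zero subfield_one subfield_add)

lemma subfield_of_int: "of_int k \<in> K"
  by (cases k) (auto intro: subfield_of_nat subfield_uminus subfield_diff subfield_one)

lemma subfield_of_rat: "of_rat r \<in> K"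
  by (cases r) (auto simp: of_rat_rat intro: subfield_of_int subfield_divide)

lemma poly_over_zero: "0 \<in> poly_over K"
  by (simp add: poly_over_def subfield_zero)

lemma poly_over_pCons: "a \<in> K \<Longrightarrow> p \<in> poly_over K \<Longrightarrow> pCons a p \<in> poly_over K"
  by (auto simp: poly_over_def coeff_pCons split: nat.splits)

lemma poly_over_const: "a \<in> K \<Longrightarrow> [:a:] \<in> poly_over K"
  by (intro poly_over_pCons poly_over_zero)

lemma poly_over_one: "1 \<in> poly_over K"
  using poly_over_const[OF subfield_one] by (simp add: one_pCons)

lemma poly_over_add: "p \<in> poly_over K \<Longrightarrow> q \<in> poly_over K \<Longrightarrow> p + q \<in> poly_over K"
  by (auto simp: poly_over_def intro: subfield_add)

lemma poly_over_diff: "p \<in> poly_over K \<Longrightarrow> q \<in> poly_over K \<Longrightarrow> p - q \<in> poly_over K"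
  by (auto simp: poly_over_def intro: subfield_diff)

lemma poly_over_uminus: "p \<in> poly_over K \<Longrightarrow> - p \<in> poly_over K"
  by (auto simp: poly_over_def intro: subfield_uminus)

lemma poly_over_smult: "a \<in> K \<Longrightarrow> p \<in> poly_over K \<Longrightarrow> Polynomial.smult a p \<in> poly_over K"
  by (auto simp: poly_over_def intro: subfield_mult)

lemma poly_over_monom: "a \<in> K \<Longrightarrow> monom a k \<in> poly_over K"
  by (auto simp: poly_over_def subfield_zero)

lemma poly_over_mult: "p \<in> poly_over K \<Longrightarrow> q \<in> poly_over K \<Longrightarrow> p * q \<in> poly_over K"
  unfolding poly_over_def
  by (auto intro: coeff_mult_semiring_closed subfield_zero subfield_add subfield_mult)

lemma poly_over_pcompose: "p \<in> poly_over K \<Longrightarrow> q \<in> poly_over K \<Longrightarrow> pcompose p q \<in> poly_over K"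
  unfolding poly_over_def
  by (auto intro: coeff_pcompose_semiring_closed subfield_zero subfield_add subfield_mult)

lemma poly_over_power: "p \<in> poly_over K \<Longrightarrow> p ^ k \<in> poly_over K"
  by (induction k) (auto intro: poly_over_one poly_over_mult)

lemma poly_over_sum: "(\<And>i. i \<in> I \<Longrightarrow> g i \<in> poly_over K) \<Longrightarrow> sum g I \<in> poly_over K"
  by (induction I rule: infinite_finite_induct) (auto intro: poly_over_zero poly_over_add)

lemma poly_over_pderiv: "p \<in> poly_over K \<Longrightarrow> pderiv p \<in> poly_over K"
  by (auto simp: poly_over_def coeff_pderiv
        intro!: subfield_mult subfield_of_nat[of "Suc _", simplified] subfield_add subfield_one subfield_of_nat)

lemma poly_over_eval: "p \<in> poly_over K \<Longrightarrow> a \<in> K \<Longrightarrow> poly p a \<in> K"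
  unfolding poly_altdef
  by (intro subfield_sum subfield_mult subfield_power) (auto intro: poly_overD)

text \<open>\<open>div\<close> and \<open>mod\<close> are taken in the large field. Long division
  only divides by the leading coefficient of \<open>g\<close>, so it can be run over
  \<open>K\<close>; uniqueness of quotient and remainder identifies the result.\<close>

lemma poly_over_division:
  assumes "p \<in> poly_over K" "g \<in> poly_over K"
  shows "p div g \<in> poly_over K" "p mod g \<in> poly_over K"
proof -
  have "\<exists>q\<in>poly_over K. \<exists>r\<in>poly_over K. p = q * g + r \<and> (r = 0 \<or> degree r < degree g)"
    if "g \<noteq> 0"
    using assms(1)
  proof (induction "degree p" arbitrary: p rule: less_induct)
    case less
    show ?case
    proof (cases "p = 0 \<or> degree p < degree g")
      case True
      thus ?thesis using less.prems poly_over_zero by (intro bexI[of _ 0] bexI[of _ p]) auto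
    next
      case False
      define c where "c = lead_coeff p / lead_coeff g"
      define t where "t = monom c (degree p - degree g)"
      define p' where "p' = p - t * g"
      have t: "t \<in> poly_over K" unfolding t_def c_def
        by (intro poly_over_monom subfield_divide poly_overD[OF less.prems] poly_overD[OF assms(2)])
      have p': "p' \<in> poly_over K" unfolding p'_def
        by (intro poly_over_diff poly_over_mult less.prems t assms)
      have "c \<noteq> 0" using False \<open>g \<noteq> 0\<close> by (simp add: c_def)
      hence t0: "t \<noteq> 0" by (simp add: t_def)
      have deg: "degree (t * g) = degree p"
        using False \<open>g \<noteq> 0\<close> t0 \<open>c \<noteq> 0\<close> by (simp add: degree_mult_eq t_def degree_monom_eq)
      have lc: "lead_coeff (t * g) = lead_coeff p"
        using \<open>g \<noteq> 0\<close> \<open>c \<noteq> 0\<close> by (simp add: lead_coeff_mult t_def c_def lead_coeff_monom degree_monom_eq)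
      have "degree p' \<le> degree p" unfolding p'_def using deg by (intro degree_diff_le) auto
      moreover have "coeff p' (degree p) = 0" using lc deg by (simp add: p'_def)
      ultimately have small: "p' = 0 \<or> degree p' < degree p"
        by (metis le_neq_implies_less leading_coeff_0_iff)
      have "\<exists>q\<in>poly_over K. \<exists>r\<in>poly_over K. p' = q * g + r \<and> (r = 0 \<or> degree r < degree g)"
      proof (cases "p' = 0")
        case True
        thus ?thesis using poly_over_zero by (intro bexI[of _ 0]) auto
      next
        case False
        thus ?thesis using less.hyps p' small by blast
      qed
      then obtain q r where qr: "q \<in> poly_over K" "r \<in> poly_over K" "p' = q * g + r"
          "r = 0 \<or> degree r < degree g" by blast
      have "p = (q + t) * g + r" using qr(3) by (simp add: p'_def algebra_simps)
      thus ?thesis using qr poly_over_add[OF qr(1) t] by blast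
    qed
  qed
  moreover have "p div g = q" "p mod g = r"
    if "p = q * g + r" "r = 0 \<or> degree r < degree g" "g \<noteq> 0" for q r
    using that by (auto simp: div_poly_less mod_poly_less)
  ultimately have "p div g \<in> poly_over K \<and> p mod g \<in> poly_over K"
    using assms(1) poly_over_zero by (cases "g = 0") force+
  thus "p div g \<in> poly_over K" "p mod g \<in> poly_over K" by auto
qed

end

subsection \<open>Minimal polynomials and simple extensions\<close>

text \<open>The predicate described by \<open>minimal_poly_over\<close>, kept as a relation so that
  it can be used apart from existence and uniqueness.\<close>

definition is_minimal_poly :: "'a::field set \<Rightarrow> 'a \<Rightarrow> 'a poly \<Rightarrow> bool" where
  "is_minimal_poly K a p \<longleftrightarrow> lead_coeff p = 1 \<and> p \<in> poly_over K \<and> poly p a = 0 \<and>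
     (\<forall>q\<in>poly_over K. q \<noteq> 0 \<and> poly q a = 0 \<longrightarrow> degree p \<le> degree q)"

lemma is_minimal_poly_degree_pos: "is_minimal_poly K a p \<Longrightarrow> degree p > 0"
  by (rule ccontr) (auto simp: is_minimal_poly_def elim!: degree_eq_zeroE)

context
  fixes K :: "'a::field_char_0 set"
  assumes K: "is_subfield K"
begin

lemma is_minimal_poly_dvd:
  assumes "is_minimal_poly K a p" "q \<in> poly_over K" "poly q a = 0"
  shows "p dvd q"
proof (rule ccontr)
  assume "\<not> p dvd q"
  hence nz: "q mod p \<noteq> 0" by (simp add: dvd_eq_mod_eq_0)
  have p0: "p \<noteq> 0" using assms(1) by (auto simp: is_minimal_poly_def)
  have "q mod p \<in> poly_over K"
    using assms by (intro poly_over_division K) (auto simp: is_minimal_poly_def)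
  moreover have "poly (q mod p) a = 0"
    using assms by (simp add: poly_mod is_minimal_poly_def)
  ultimately have "degree p \<le> degree (q mod p)"
    using assms(1) nz by (auto simp: is_minimal_poly_def)
  thus False using degree_mod_less'[OF p0 nz] by simp
qed

text \<open>Justifies the definite description: an annihilating polynomial of least degree can be
  made monic, and the difference of two such polynomials would annihilate \<open>a\<close> in
  smaller degree.\<close>

lemma is_minimal_poly_minimal_poly_over:
  assumes "q \<in> poly_over K" "q \<noteq> 0" "poly q a = 0"
  shows "is_minimal_poly K a (minimal_poly_over K a)"
proof -
  define P where "P = (\<lambda>q. q \<in> poly_over K \<and> q \<noteq> 0 \<and> poly q a = 0)"
  obtain p where p: "P p" "\<And>q. P q \<Longrightarrow> degree p \<le> degree q"
    using exists_least_iff[of "\<lambda>d. \<exists>q. P q \<and> degree q = d"] assms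
    unfolding P_def by (metis not_le)
  define r where "r = Polynomial.smult (inverse (lead_coeff p)) p"
  have r: "is_minimal_poly K a r"
    using p unfolding is_minimal_poly_def r_def P_def
    by (auto intro!: poly_over_smult[OF K] subfield_inverse[OF K] poly_overD)
  have unique: "s = r" if s: "is_minimal_poly K a s" for s
  proof (rule ccontr)
    assume neq: "s \<noteq> r"
    have "r \<noteq> 0" "s \<noteq> 0" using r s by (auto simp: is_minimal_poly_def)
    hence deg: "degree s = degree r"
      using r s unfolding is_minimal_poly_def by (meson order_antisym)
    have "degree (s - r) < degree s"
    proof (rule degree_less_if_less_eqI)
      show "degree (s - r) \<le> degree s" using deg by (intro degree_diff_le) auto
      show "coeff (s - r) (degree s) = 0" using r s deg by (simp add: is_minimal_poly_def)
      show "s - r \<noteq> 0" using neq by simp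
    qed
    moreover have "s - r \<in> poly_over K" "poly (s - r) a = 0" "s - r \<noteq> 0"
      using r s neq by (auto simp: is_minimal_poly_def intro: poly_over_diff[OF K])
    hence "degree s \<le> degree (s - r)"
      using s unfolding is_minimal_poly_def by blast
    ultimately show False by simp
  qed
  have "minimal_poly_over K a = (THE p. is_minimal_poly K a p)"
    unfolding minimal_poly_over_def is_minimal_poly_def poly_over_def
    by (intro arg_cong[where f = The] ext) blast
  also have "\<dots> = r" by (rule the_equality, rule r, rule unique)
  finally show ?thesis using r by simp
qed

text \<open>A Euclidean descent on the degree: with \<open>h = u * p + r\<close> one gets r(a) =
  -u(a) p(a), so an inverse w(a) of r(a) yields the inverse -w(a) u(a) of p(a).\<close>

lemma simple_extension_inverse:
  assumes h: "is_minimal_poly K a h" and "p \<in> poly_over K" "poly p a \<noteq> 0"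
  shows "\<exists>w\<in>poly_over K. poly w a * poly p a = 1"
proof -
  have h': "h \<in> poly_over K" "h \<noteq> 0" "poly h a = 0"
    and min: "\<And>q. q \<in> poly_over K \<Longrightarrow> q \<noteq> 0 \<Longrightarrow> poly q a = 0 \<Longrightarrow> degree h \<le> degree q"
    using h by (auto simp: is_minimal_poly_def)
  have *: "\<exists>w\<in>poly_over K. poly w a * poly p a = 1"
    if "p \<in> poly_over K" "p \<noteq> 0" "degree p < degree h" for p
    using that
  proof (induction "degree p" arbitrary: p rule: less_induct)
    case less
    show ?case
    proof (cases "degree p = 0")
      case True
      then obtain c where c: "p = [:c:]" by (rule degree_eq_zeroE)
      hence "c \<in> K" using poly_overD[OF less.prems(1), of 0] by simp
      thus ?thesis using less.prems(2) c
        by (intro bexI[of _ "[:inverse c:]"]) (auto intro: poly_over_const[OF K] subfield_inverse[OF K])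
    next
      case False
      define u r where "u = h div p" and "r = h mod p"
      have u: "u \<in> poly_over K" and r: "r \<in> poly_over K"
        unfolding u_def r_def by (intro poly_over_division[OF K] h' less.prems)+
      have hpr: "h = u * p + r" by (simp add: u_def r_def)
      \<comment> \<open>Otherwise \<open>h = u * p\<close>, and \<open>u\<close> would annihilate
        \<open>a\<close> in degree below that of \<open>h\<close>.\<close>
      have "r \<noteq> 0"
      proof
        assume "r = 0"
        hence eq: "h = u * p" using hpr by simp
        hence "u \<noteq> 0" using h' by auto
        have "poly p a \<noteq> 0" using min[OF less.prems(1,2)] less.prems(3) by auto
        hence "poly u a = 0" using eq h' by auto
        hence "degree h \<le> degree u" using min[OF u \<open>u \<noteq> 0\<close>] by simp
        moreover have "degree h = degree u + degree p"
          unfolding eq by (rule degree_mult_eq) (use \<open>u \<noteq> 0\<close> less.prems in auto)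
        ultimately show False using False by simp
      qed
      hence "degree r < degree p"
        unfolding r_def by (intro degree_mod_less' less.prems)
      then obtain w where w: "w \<in> poly_over K" "poly w a * poly r a = 1"
        using less.hyps[of r] r \<open>r \<noteq> 0\<close> less.prems(3) by auto
      have "poly r a = - (poly u a * poly p a)"
        using arg_cong[OF hpr, of "\<lambda>q. poly q a"] h' by (simp add: eq_neg_iff_add_eq_0 add.commute)
      hence "poly (- (w * u)) a * poly p a = 1" using w(2) by (simp add: mult_ac)
      thus ?thesis using poly_over_uminus[OF K poly_over_mult[OF K w(1) u]] by blast
    qed
  qed
  define p' where "p' = p mod h"
  have "poly p' a = poly p a" by (simp add: p'_def poly_mod h')
  moreover have "p' \<in> poly_over K" unfolding p'_def by (intro poly_over_division[OF K] assms h')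
  moreover have "p' \<noteq> 0" using \<open>poly p' a = poly p a\<close> assms by auto
  moreover have "degree p' < degree h"
    using degree_mod_less'[OF h'(2)] \<open>p' \<noteq> 0\<close> by (simp add: p'_def)
  ultimately show ?thesis using *[of p'] by simp
qed

lemma is_subfield_simple_extension:
  assumes "is_minimal_poly K a h"
  shows "is_subfield ((\<lambda>p. poly p a) ` poly_over K)" (is "is_subfield ?L")
  unfolding is_subfield_def
proof (intro conjI ballI)
  show "0 \<in> ?L" by (rule image_eqI[of _ _ 0]) (auto intro: poly_over_zero[OF K])
  show "1 \<in> ?L" by (rule image_eqI[of _ _ 1]) (auto intro: poly_over_one[OF K])
next
  fix s t assume "s \<in> ?L" "t \<in> ?L"
  then obtain p q where "p \<in> poly_over K" "q \<in> poly_over K" "s = poly p a" "t = poly q a" by auto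
  thus "s + t \<in> ?L" "s * t \<in> ?L"
    by (intro image_eqI[of _ _ "p + q"] image_eqI[of _ _ "p * q"];
        simp add: poly_over_add[OF K] poly_over_mult[OF K])+
next
  fix s assume "s \<in> ?L"
  then obtain p where p: "p \<in> poly_over K" "s = poly p a" by auto
  show "- s \<in> ?L" using p by (auto intro!: image_eqI[of _ _ "- p"] poly_over_uminus[OF K])
  show "inverse s \<in> ?L"
  proof (cases "s = 0")
    case True
    thus ?thesis by (intro image_eqI[of _ _ 0]) (auto intro: poly_over_zero[OF K])
  next
    case False
    then obtain w where "w \<in> poly_over K" "poly w a * s = 1"
      using simple_extension_inverse[OF assms p(1)] p(2) by auto
    thus ?thesis by (intro image_eqI[of _ _ w]) (auto simp: inverse_unique mult.commute)
  qed
qed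

end

section \<open>Generated subfields and the steps of the tower\<close>

lemma is_subfield_gen_field: "is_subfield (gen_field S)"
  unfolding gen_field_def by (rule hull_in) (auto simp: is_subfield_def)

lemma gen_field_superset: "S \<subseteq> gen_field S"
  unfolding gen_field_def by (rule hull_subset)

lemma gen_field_mono: "S \<subseteq> T \<Longrightarrow> gen_field S \<subseteq> gen_field T"
  unfolding gen_field_def by (rule hull_mono)

lemma gen_field_minimal: "S \<subseteq> K \<Longrightarrow> is_subfield K \<Longrightarrow> gen_field S \<subseteq> K"
  unfolding gen_field_def by (rule hull_minimal)

lemma is_subfield_Rats: "is_subfield (\<rat> :: 'a::field_char_0 set)"
  by (auto simp: is_subfield_def)

lemma gen_field_empty: "gen_field {} = \<rat>"
  using gen_field_minimal[OF _ is_subfield_Rats, of "{}"] subfield_of_rat[OF is_subfield_gen_field, of _ "{}"]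
  by (auto simp: Rats_def)

text \<open>Since the new root is algebraic, its polynomial expressions already form a field, and
  the hull is the smallest one.\<close>

lemma tower_field_Suc:
  assumes "is_minimal_poly (tower_field x j) (x (Suc j)) h"
  shows "tower_field x (Suc j) = (\<lambda>p. poly p (x (Suc j))) ` poly_over (tower_field x j)" (is "_ = ?L")
proof
  have K: "is_subfield (tower_field x j)"
    unfolding tower_field_def by (rule is_subfield_gen_field)
  have "tower_field x j \<subseteq> ?L"
    by (auto intro!: image_eqI[of _ _ "[:_:]"] poly_over_const[OF K])
  hence "x ` {1..j} \<subseteq> ?L"
    using gen_field_superset[of "x ` {1..j}"] by (auto simp: tower_field_def)
  moreover have "x (Suc j) \<in> ?L"
    by (rule image_eqI[of _ _ "[:0, 1:]"])
       (auto intro!: poly_over_pCons[OF K] poly_over_zero[OF K] subfield_zero[OF K] subfield_one[OF K])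
  ultimately show "tower_field x (Suc j) \<subseteq> ?L"
    unfolding tower_field_def[of x "Suc j"]
    by (intro gen_field_minimal is_subfield_simple_extension[OF K assms])
       (auto simp: atLeastAtMostSuc_conv)
next
  let ?K = "tower_field x (Suc j)"
  have K: "is_subfield ?K"
    unfolding tower_field_def by (rule is_subfield_gen_field)
  have "tower_field x j \<subseteq> ?K"
    unfolding tower_field_def by (intro gen_field_mono image_mono) auto
  moreover have "x (Suc j) \<in> ?K"
    unfolding tower_field_def using gen_field_superset[of "x ` {1..Suc j}"] by auto
  ultimately show "?L \<subseteq> ?K"
    using poly_over_mono by (auto intro!: poly_over_eval[OF K])
qed

subsection \<open>Products of linear factors\<close>

text \<open>The product runs over indices, not over values, so repeated roots count with
  multiplicity; this matters before the roots are known to be distinct and for families such as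
  \<open>poly h (x r)\<close>.\<close>

definition root_poly :: "('i \<Rightarrow> 'a::comm_ring_1) \<Rightarrow> 'i set \<Rightarrow> 'a poly" where
  "root_poly x S = (\<Prod>s\<in>S. [:- x s, 1:])"

lemma root_poly_insert:
  "finite S \<Longrightarrow> a \<notin> S \<Longrightarrow> root_poly x (insert a S) = [:- x a, 1:] * root_poly x S"
  by (simp add: root_poly_def)

lemma root_poly_remove:
  "finite S \<Longrightarrow> a \<in> S \<Longrightarrow> root_poly x S = [:- x a, 1:] * root_poly x (S - {a})"
  by (simp add: root_poly_def prod.remove)

lemma monic_root_poly:
  fixes x :: "'i \<Rightarrow> 'a::idom"
  shows "lead_coeff (root_poly x S) = 1"
  by (simp add: root_poly_def lead_coeff_prod)

lemma root_poly_nonzero: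
  fixes x :: "'i \<Rightarrow> 'a::idom"
  shows "root_poly x S \<noteq> 0"
  using monic_root_poly[of x S] by auto

lemma degree_root_poly:
  fixes x :: "'i \<Rightarrow> 'a::idom"
  shows "degree (root_poly x S) = card S"
proof (induction S rule: infinite_finite_induct)
  case (insert a S)
  thus ?case
    using degree_mult_eq[of "[:- x a, 1:]" "root_poly x S"] root_poly_nonzero[of x S]
    by (simp add: root_poly_insert)
qed (simp_all add: root_poly_def)

lemma poly_root_poly: "poly (root_poly x S) t = (\<Prod>s\<in>S. t - x s)"
  by (simp add: root_poly_def poly_prod)

lemma poly_root_poly_root: "finite S \<Longrightarrow> r \<in> S \<Longrightarrow> poly (root_poly x S) (x r) = 0"
  by (simp add: root_poly_remove)

lemma pderiv_root_poly:
  fixes x :: "'i \<Rightarrow> 'a::idom"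
  shows "pderiv (root_poly x S) = (\<Sum>r\<in>S. root_poly x (S - {r}))"
  by (simp add: root_poly_def pderiv_prod pderiv_pCons)

lemma poly_pderiv_root_poly:
  fixes x :: "'i \<Rightarrow> 'a::idom"
  assumes "finite S" "r \<in> S"
  shows "poly (pderiv (root_poly x S)) (x r) = (\<Prod>s\<in>S - {r}. x r - x s)"
proof -
  have "poly (pderiv (root_poly x S)) (x r) =
    (\<Sum>u\<in>S. if u = r then \<Prod>s\<in>S - {r}. x r - x s else 0)"
    unfolding pderiv_root_poly poly_sum
    using assms by (intro sum.cong refl) (auto simp: poly_root_poly)
  thus ?thesis using assms by simp
qed

text \<open>Induction on \<open>S\<close>, one linear factor at a time: it is taken out of
  \<open>h\<close> when \<open>h\<close> vanishes at \<open>x a\<close>, and cancelled from the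
  cofactor otherwise.\<close>

lemma monic_dvd_root_poly:
  fixes x :: "'i \<Rightarrow> 'a::field"
  assumes "finite S" "h dvd root_poly x S" "lead_coeff h = 1"
  shows "\<exists>R\<subseteq>S. h = root_poly x R"
  using assms
proof (induction S arbitrary: h rule: finite_induct)
  case empty
  hence "is_unit h" by (simp add: root_poly_def)
  then obtain c where "h = [:c:]" by (metis is_unit_poly_iff)
  hence "h = 1" using empty(2) by (simp add: one_pCons)
  thus ?case by (auto simp: root_poly_def)
next
  case (insert a S)
  show ?case
  proof (cases "poly h (x a) = 0")
    case True
    then obtain h' where h': "h = [:- x a, 1:] * h'" by (auto simp: poly_eq_0_iff_dvd)
    have "h' dvd root_poly x S"
      using insert.prems(1) insert.hyps unfolding h' by (simp add: root_poly_insert del: mult_pCons_left)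
    moreover have "lead_coeff h' = 1"
      using insert.prems(2) unfolding h' lead_coeff_mult by simp
    ultimately obtain R where R: "R \<subseteq> S" "h' = root_poly x R" using insert.IH by blast
    hence "h = root_poly x (insert a R)"
      using insert.hyps h' finite_subset[of R S] by (subst root_poly_insert) auto
    thus ?thesis using R by (intro exI[of _ "insert a R"]) auto
  next
    case False
    obtain q where q: "[:- x a, 1:] * root_poly x S = h * q"
      using insert.prems(1) insert.hyps by (auto simp: root_poly_insert dvd_def)
    have "poly (h * q) (x a) = 0" unfolding q[symmetric] by simp
    hence "poly q (x a) = 0" using False by simp
    then obtain q' where "q = [:- x a, 1:] * q'" by (auto simp: poly_eq_0_iff_dvd)
    hence "[:- x a, 1:] * root_poly x S = [:- x a, 1:] * (h * q')" using q by (simp only: mult_ac)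
    hence "root_poly x S = h * q'" by (simp only: mult_cancel_left) simp
    hence "h dvd root_poly x S" by simp
    thus ?thesis using insert.IH insert.prems(2) by blast
  qed
qed

subsection \<open>Symmetric expressions in the roots\<close>

text \<open>\<open>h\<close> times the derivative of \<open>f\<close> is congruent modulo
  \<open>f\<close> to the polynomial \<open>g\<close> below, because T - x_r divides h - h(x_r).
  Division stays over \<open>K\<close>, and the top coefficient of \<open>g\<close> is the sum in
  question.\<close>

lemma sum_poly_roots_in_subfield:
  assumes K: "is_subfield K" and S: "finite S"
    and f: "root_poly x S \<in> poly_over K" and h: "h \<in> poly_over K"
  shows "(\<Sum>r\<in>S. poly h (x r)) \<in> (K :: 'a::field_char_0 set)"
proof (cases "S = {}")
  case True
  thus ?thesis by (simp add: subfield_zero[OF K])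
next
  case False
  hence card: "card S > 0" using S by auto
  define f where "f = root_poly x S"
  define g where "g = (\<Sum>r\<in>S. Polynomial.smult (poly h (x r)) (root_poly x (S - {r})))"
  have "degree g \<le> card S - 1"
    unfolding g_def using S
    by (intro degree_sum_le order.trans[OF degree_smult_le]) (auto simp: degree_root_poly)
  hence "degree g < degree f"
    using card by (simp add: f_def degree_root_poly)
  have "f dvd h * pderiv f - g"
  proof -
    have "h * pderiv f - g = (\<Sum>r\<in>S. (h - [:poly h (x r):]) * root_poly x (S - {r}))"
      unfolding f_def pderiv_root_poly g_def
      by (simp add: sum_distrib_left sum_subtractf algebra_simps)
    moreover have "f dvd (h - [:poly h (x r):]) * root_poly x (S - {r})" if "r \<in> S" for r
    proof -
      have "[:- x r, 1:] dvd h - [:poly h (x r):]" by (simp flip: poly_eq_0_iff_dvd)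
      thus ?thesis unfolding f_def root_poly_remove[OF S that] by (intro mult_dvd_mono) auto
    qed
    ultimately show ?thesis by (auto intro: dvd_sum)
  qed
  hence "h * pderiv f mod f = g mod f" by (simp add: mod_eq_dvd_iff)
  also have "\<dots> = g" using \<open>degree g < degree f\<close> by (rule mod_poly_less)
  finally have "h * pderiv f mod f = g" .
  moreover have "h * pderiv f mod f \<in> poly_over K"
    using f unfolding f_def
    by (intro poly_over_division[OF K] poly_over_mult[OF K] h poly_over_pderiv[OF K])
  ultimately have "coeff g (card S - 1) \<in> K" by (simp add: poly_overD)
  also have "coeff g (card S - 1) = (\<Sum>r\<in>S. poly h (x r))"
    unfolding g_def coeff_sum
  proof (intro sum.cong refl)
    fix r assume "r \<in> S"
    thus "coeff (Polynomial.smult (poly h (x r)) (root_poly x (S - {r}))) (card S - 1) = poly h (x r)"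
      using monic_root_poly[of x "S - {r}"] S by (simp add: degree_root_poly)
  qed
  finally show ?thesis .
qed

text \<open>
  Newton's identities: with \<open>q\<^sub>r = \<Prod>\<^sub>s\<^sub>\<noteq>\<^sub>r (T - z\<^sub>s)\<close> and \<open>c\<close> the full product, the sums
  \<open>A m k = \<Sum>\<^sub>r z\<^sub>r\<^sup>k coeff q\<^sub>r m\<close> satisfy \<open>c\<^sub>m p\<^sub>k = A (m-1) k - A m (k+1)\<close> and \<open>A (m-1) 0 = m c\<^sub>m\<close>,
  which determines the \<open>c\<^sub>m\<close> from the power sums \<open>p\<^sub>k\<close> by descending recursion on \<open>m\<close>.
\<close>

lemma root_poly_over_if_power_sums:
  assumes K: "is_subfield K" and S: "finite S"
    and p: "\<And>k. (\<Sum>r\<in>S. z r ^ k) \<in> (K :: 'a::field_char_0 set)"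
  shows "root_poly z S \<in> poly_over K"
proof -
  define c where "c = root_poly z S"
  define q where "q = (\<lambda>r. root_poly z (S - {r}))"
  define A where "A = (\<lambda>m k. \<Sum>r\<in>S. z r ^ k * coeff (q r) m)"
  \<comment> \<open>\<open>A'\<close> is \<open>A\<close> with the index lowered by one; the value 0
    at \<open>m = 0\<close> stands for the index -1.\<close>
  define A' where "A' = (\<lambda>m k. case m of 0 \<Rightarrow> 0 | Suc m \<Rightarrow> A m k)"
  have A': "A' m 0 = of_nat m * coeff c m" for m
  proof (cases m)
    case (Suc i)
    have "A i 0 = coeff (pderiv c) i"
      by (simp add: A_def c_def q_def pderiv_root_poly coeff_sum)
    thus ?thesis by (simp add: Suc A'_def coeff_pderiv)
  qed (simp add: A'_def)
  have aux: "a * w = w * b - (u * w) * y" if "a = b - u * y" for a b u y w :: 'a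
    unfolding that by (simp add: algebra_simps)
  have rec: "coeff c m * (\<Sum>r\<in>S. z r ^ k) = A' m k - A m (Suc k)" for m k
  proof -
    have "coeff c m * z r ^ k =
        (case m of 0 \<Rightarrow> 0 | Suc m \<Rightarrow> z r ^ k * coeff (q r) m) - z r ^ Suc k * coeff (q r) m"
      if "r \<in> S" for r
    proof -
      have "c = [:- z r, 1:] * q r"
        unfolding c_def q_def by (rule root_poly_remove[OF S that])
      hence "coeff c m = coeff (pCons 0 (q r)) m - z r * coeff (q r) m" by simp
      hence "coeff c m * z r ^ k =
          z r ^ k * coeff (pCons 0 (q r)) m - z r ^ Suc k * coeff (q r) m"
        unfolding power_Suc by (rule aux)
      thus ?thesis by (cases m) simp_all
    qed
    hence "coeff c m * (\<Sum>r\<in>S. z r ^ k) = (\<Sum>r\<in>S. (case m of 0 \<Rightarrow> 0 | Suc m \<Rightarrow> z r ^ k * coeff (q r) m)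
        - z r ^ Suc k * coeff (q r) m)"
      unfolding sum_distrib_left by (intro sum.cong refl)
    also have "\<dots> = A' m k - A m (Suc k)"
      unfolding sum_subtractf A'_def A_def by (cases m) auto
    finally show ?thesis .
  qed
  have coeff_c: "coeff c m \<in> K" if "\<And>k. A m k \<in> K" for m
  proof (cases "m = card S")
    case True
    hence "coeff c m = 1" using monic_root_poly[of z S] by (simp add: c_def degree_root_poly)
    thus ?thesis by (simp add: subfield_one[OF K])
  next
    case False
    \<comment> \<open>For \<open>k = 0\<close> the recursion is solved for \<open>coeff c m\<close>:
      the power sum is \<open>card S\<close>, and \<open>m - card S\<close> is invertible in
      characteristic 0.\<close>
    have "coeff c m * of_nat (card S) = of_nat m * coeff c m - A m (Suc 0)"
      using rec[of m 0] A'[of m] by simp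
    hence "coeff c m * (of_nat m - of_nat (card S)) = A m (Suc 0)" by (simp add: algebra_simps)
    moreover have "(of_nat m - of_nat (card S) :: 'a) \<noteq> 0" using False by simp
    ultimately have "coeff c m = A m (Suc 0) / (of_nat m - of_nat (card S))"
      by (simp add: nonzero_eq_divide_eq)
    thus ?thesis
      by (simp add: that subfield_divide[OF K] subfield_diff[OF K] subfield_of_nat[OF K])
  qed
  have A_in: "A m k \<in> K" if "m \<le> card S" for m k
    using that
  proof (induction m arbitrary: k rule: inc_induct)
    case base
    have "coeff (q r) (card S) = 0" if "r \<in> S" for r
      using card_Diff1_less[OF S that] by (intro coeff_eq_0) (simp add: q_def degree_root_poly)
    thus ?case by (simp add: A_def subfield_zero[OF K])
  next
    case (step m)
    have "A m k = A' (Suc m) k" by (simp add: A'_def)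
    also have "\<dots> = coeff c (Suc m) * (\<Sum>r\<in>S. z r ^ k) + A (Suc m) (Suc k)"
      using rec[of "Suc m" k] by simp
    also have "\<dots> \<in> K"
      by (rule subfield_add[OF K subfield_mult[OF K coeff_c[OF step.IH] p] step.IH])
    finally show ?case .
  qed
  show ?thesis
    unfolding c_def[symmetric]
  proof (rule poly_overI)
    fix m
    show "coeff c m \<in> K"
    proof (cases "m \<le> card S")
      case True
      thus ?thesis by (intro coeff_c A_in)
    next
      case False
      hence "coeff c m = 0" by (intro coeff_eq_0) (simp add: c_def degree_root_poly)
      thus ?thesis by (simp add: subfield_zero[OF K])
    qed
  qed
qed

text \<open>Up to sign this is the constant term of the polynomial with roots h(x_r), whose power
  sums are the sums of the values of \<open>h ^ k\<close>.\<close>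

lemma prod_poly_roots_in_subfield:
  assumes K: "is_subfield K" and S: "finite S"
    and f: "root_poly x S \<in> poly_over K" and h: "h \<in> poly_over K"
  shows "(\<Prod>r\<in>S. poly h (x r)) \<in> (K :: 'a::field_char_0 set)"
proof -
  have "root_poly (\<lambda>r. poly h (x r)) S \<in> poly_over K"
  proof (rule root_poly_over_if_power_sums[OF K S])
    fix k
    show "(\<Sum>r\<in>S. poly h (x r) ^ k) \<in> K"
      using sum_poly_roots_in_subfield[OF K S f poly_over_power[OF K h, of k]] by (simp add: poly_power)
  qed
  hence "poly (root_poly (\<lambda>r. poly h (x r)) S) 0 \<in> K"
    by (rule poly_over_eval[OF K _ subfield_zero[OF K]])
  hence "(\<Prod>r\<in>S. - poly h (x r)) \<in> K" by (simp add: poly_root_poly)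
  hence "(- 1) ^ card S * (\<Prod>r\<in>S. - poly h (x r)) \<in> K"
    by (intro subfield_mult[OF K] subfield_power[OF K] subfield_uminus[OF K] subfield_one[OF K])
  also have "(- 1) ^ card S * (\<Prod>r\<in>S. - poly h (x r)) = (\<Prod>r\<in>S. - 1 * - poly h (x r))"
    by (simp only: prod.distrib prod_constant)
  finally show ?thesis by simp
qed

subsection \<open>Products of root differences\<close>

text \<open>The product over ordered pairs: up to sign the square of the Vandermonde product. It is
  symmetric in the roots and asks for no order on the indices.\<close>

definition diff_prod :: "('i \<Rightarrow> 'a::comm_ring_1) \<Rightarrow> 'i set \<Rightarrow> 'a" where
  "diff_prod y S = (\<Prod>r\<in>S. \<Prod>s\<in>S - {r}. y r - y s)"

text \<open>Each pair of \<open>a\<close> with an old index occurs in both orders; turning one of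
  them round costs the sign.\<close>

lemma diff_prod_insert:
  assumes "finite S" "a \<notin> S"
  shows "diff_prod y (insert a S) = (- 1) ^ card S * (\<Prod>s\<in>S. y a - y s)\<^sup>2 * diff_prod y S"
proof -
  have "(\<Prod>s\<in>insert a S - {r}. y r - y s) = (- 1) * (y a - y r) * (\<Prod>s\<in>S - {r}. y r - y s)"
    if "r \<in> S" for r
  proof -
    have "insert a S - {r} = insert a (S - {r})" using assms that by auto
    thus ?thesis using assms by simp
  qed
  hence "(\<Prod>r\<in>S. \<Prod>s\<in>insert a S - {r}. y r - y s) =
      (\<Prod>r\<in>S. (- 1) * (y a - y r) * (\<Prod>s\<in>S - {r}. y r - y s))"
    by (intro prod.cong refl)
  also have "\<dots> = (- 1) ^ card S * (\<Prod>r\<in>S. y a - y r) * diff_prod y S"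
    by (simp only: prod.distrib prod_constant diff_prod_def)
  finally have "(\<Prod>r\<in>S. \<Prod>s\<in>insert a S - {r}. y r - y s) =
      (- 1) ^ card S * (\<Prod>r\<in>S. y a - y r) * diff_prod y S" .
  moreover have "insert a S - {a} = S" using assms by auto
  ultimately show ?thesis
    using assms by (simp add: diff_prod_def power2_eq_square mult_ac)
qed

lemma diff_prod_remove:
  assumes "finite S" "r \<in> S"
  shows "diff_prod y S =
    (- 1) ^ (card S - 1) * (\<Prod>s\<in>S - {r}. y r - y s)\<^sup>2 * diff_prod y (S - {r})"
  using diff_prod_insert[of "S - {r}" r y] assms by (simp add: insert_absorb)

lemma root_disc_Suc: "root_disc (Suc n) x = (\<Prod>r=1..n. x (Suc n) - x r)\<^sup>2 * root_disc n x"
proof -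
  let ?P = "\<lambda>n. {(r, s). 1 \<le> r \<and> r < s \<and> s \<le> (n::nat)}"
  have fin: "finite (?P n)" by (rule finite_subset[of _ "{1..n} \<times> {1..n}"]) auto
  have "?P (Suc n) = ?P n \<union> (\<lambda>r. (r, Suc n)) ` {1..n}" by (auto simp: le_Suc_eq)
  hence "root_disc (Suc n) x =
      root_disc n x * (\<Prod>(r, s)\<in>(\<lambda>r. (r, Suc n)) ` {1..n}. (x r - x s)\<^sup>2)"
    unfolding root_disc_def using fin by (simp only:) (subst prod.union_disjoint; auto)
  also have "(\<Prod>(r, s)\<in>(\<lambda>r. (r, Suc n)) ` {1..n}. (x r - x s)\<^sup>2) = (\<Prod>r=1..n. x (Suc n) - x r)\<^sup>2"
    by (subst prod.reindex)
       (auto simp: inj_on_def prod_power_distrib intro!: prod.cong power2_commute)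
  finally show ?thesis by (simp add: mult.commute)
qed

text \<open>\<open>n * (n - 1)\<close> counts the ordered pairs, each contributing one
  \<open>c\<close>. The sign stays an unspecified power of -1; multiplying by it once more cancels
  it.\<close>

lemma diff_prod_scaled_eq_root_disc:
  "\<exists>k. diff_prod (\<lambda>r. c * x r) {1..n} = (- 1) ^ k * (c ^ (n * (n - 1)) * root_disc n x)"
proof (induction n)
  case 0
  have "root_disc 0 x = 1" unfolding root_disc_def by (rule prod.neutral) auto
  thus ?case by (intro exI[of _ 0]) (simp add: diff_prod_def)
next
  case (Suc n)
  then obtain k where k: "diff_prod (\<lambda>r. c * x r) {1..n} =
      (- 1) ^ k * (c ^ (n * (n - 1)) * root_disc n x)" by blast
  have "(\<Prod>s=1..n. c * x (Suc n) - c * x s) = c ^ n * (\<Prod>s=1..n. x (Suc n) - x s)"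
    by (simp add: prod.distrib flip: right_diff_distrib)
  moreover have "{1..Suc n} = insert (Suc n) {1..n}" by auto
  moreover have "c ^ (Suc n * n) = c ^ (n * (n - 1)) * (c ^ n)\<^sup>2"
  proof -
    have "Suc n * n = n * (n - 1) + 2 * n" by (cases n) simp_all
    thus ?thesis by (simp only: power_add power_even_eq)
  qed
  ultimately have "diff_prod (\<lambda>r. c * x r) {1..Suc n} =
      (- 1) ^ (n + k) * (c ^ (Suc n * (Suc n - 1)) * root_disc (Suc n) x)"
    by (simp add: diff_prod_insert k[unfolded One_nat_def] root_disc_Suc power_add
        power_mult_distrib mult_ac)
  thus ?case by blast
qed

text \<open>One polynomial has these products as its values at all the roots, which opens them to
  symmetric functions and to conjugation.\<close>

lemma prod_scaled_diffs:
  fixes c :: "'a::field_char_0"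
  assumes "finite S" "r \<in> S"
  shows "(\<Prod>s\<in>S - {r}. c * x r - c * x s) =
    poly (Polynomial.smult (c ^ (card S - 1)) (pderiv (root_poly x S))) (x r)"
  using assms by (simp add: poly_pderiv_root_poly prod.distrib flip: right_diff_distrib)

lemma diff_prod_in_subfield:
  fixes c :: "'a::field_char_0"
  assumes K: "is_subfield K" and S: "finite S" and g: "root_poly x S \<in> poly_over K" and c: "c \<in> K"
  shows "diff_prod (\<lambda>r. c * x r) S \<in> K"
proof -
  have "diff_prod (\<lambda>r. c * x r) S =
      (\<Prod>r\<in>S. poly (Polynomial.smult (c ^ (card S - 1)) (pderiv (root_poly x S))) (x r))"
    unfolding diff_prod_def by (intro prod.cong refl prod_scaled_diffs S)
  also have "\<dots> \<in> K"
    by (intro prod_poly_roots_in_subfield[OF K S g] poly_over_smult[OF K] poly_over_pderiv[OF K]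
        subfield_power[OF K] g c)
  finally show ?thesis .
qed

subsection \<open>Descending along a simple extension\<close>

text \<open>If \<open>q\<close> is a monic integer polynomial with zero P(a), then q(P(T)) has
  coefficients in \<open>K\<close> and vanishes at \<open>a\<close>, hence is divisible by
  \<open>h\<close> and vanishes at \<open>b\<close>.\<close>

lemma conjugate_algebraic_int:
  assumes K: "is_subfield K" and h: "is_minimal_poly K a h"
    and P: "P \<in> poly_over K" "algebraic_int (poly P a)" and b: "poly h b = 0"
  shows "algebraic_int (poly P b :: 'a::field_char_0)"
proof -
  from P(2) obtain q where q: "lead_coeff q = 1" "\<And>i. coeff q i \<in> \<int>" "poly q (poly P a) = 0"
    by (auto elim: algebraic_int.cases)
  have "q \<in> poly_over K"
    using q(2) by (intro poly_overI) (metis Ints_cases subfield_of_int[OF K])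
  hence "h dvd pcompose q P"
    by (intro is_minimal_poly_dvd[OF K h] poly_over_pcompose[OF K] P)
       (use q(3) in \<open>simp_all add: poly_pcompose\<close>)
  hence "poly (pcompose q P) b = 0" using b by (auto simp: dvd_def)
  thus ?thesis using q by (intro algebraic_int.intros[of q]) (auto simp: poly_pcompose)
qed

lemma lagrange_interpolation:
  fixes x :: "'i \<Rightarrow> 'a::field"
  assumes R: "finite R" and inj: "inj_on x R" and deg: "degree B < card R"
  shows "B = (\<Sum>r\<in>R. Polynomial.smult (poly B (x r) / (\<Prod>s\<in>R - {r}. x r - x s))
                 (root_poly x (R - {r})))"
proof (rule poly_eqI_degree)
  fix t assume "t \<in> x ` R"
  then obtain u where u: "u \<in> R" "t = x u" by auto
  have "(\<Prod>s\<in>R - {u}. x u - x s) \<noteq> 0"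
    using u inj R by (auto simp: inj_on_def)
  moreover have "poly (\<Sum>r\<in>R. Polynomial.smult (poly B (x r) / (\<Prod>s\<in>R - {r}. x r - x s))
                 (root_poly x (R - {r}))) t =
      (\<Sum>r\<in>R. if r = u then poly B (x u) / (\<Prod>s\<in>R - {u}. x u - x s) * (\<Prod>s\<in>R - {u}. x u - x s) else 0)"
    unfolding poly_sum using u R by (intro sum.cong refl) (auto simp: poly_root_poly)
  ultimately show "poly B t = poly (\<Sum>r\<in>R. Polynomial.smult (poly B (x r) / (\<Prod>s\<in>R - {r}. x r - x s))
                 (root_poly x (R - {r}))) t"
    using u R by simp
next
  show "degree B < card (x ` R)" using deg inj by (simp add: card_image)
  have "degree (\<Sum>r\<in>R. Polynomial.smult (poly B (x r) / (\<Prod>s\<in>R - {r}. x r - x s))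
                 (root_poly x (R - {r}))) \<le> card R - 1"
    using R by (intro degree_sum_le order.trans[OF degree_smult_le]) (auto simp: degree_root_poly)
  thus "degree (\<Sum>r\<in>R. Polynomial.smult (poly B (x r) / (\<Prod>s\<in>R - {r}. x r - x s))
                 (root_poly x (R - {r}))) < card (x ` R)"
    using deg inj by (simp add: card_image)
qed

text \<open>One \<open>c\<close> goes into each linear factor, giving c T - c x_s with integral
  coefficients.\<close>

lemma algebraic_int_coeff_scaled_root_poly:
  fixes c :: "'a::field_char_0"
  assumes "algebraic_int c" "\<And>s. s \<in> S \<Longrightarrow> algebraic_int (c * x s)"
  shows "algebraic_int (c ^ card S * coeff (root_poly x S) m)"
proof -
  let ?O = "{z :: 'a. algebraic_int z}"
  have "(\<Prod>s\<in>S. [:- (c * x s), c:]) \<in> poly_over ?O"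
    using assms(2)
  proof (induction S rule: infinite_finite_induct)
    case (insert s S)
    have "[:- (c * x s), c:] \<in> poly_over ?O"
      using assms(1) insert.prems by (auto simp: poly_over_def coeff_pCons split: nat.splits)
    moreover have "(\<Prod>s\<in>S. [:- (c * x s), c:]) \<in> poly_over ?O"
      using insert by blast
    ultimately have "[:- (c * x s), c:] * (\<Prod>s\<in>S. [:- (c * x s), c:]) \<in> poly_over ?O"
      unfolding poly_over_def
      by (intro CollectI allI coeff_mult_semiring_closed) (auto intro: algebraic_int_add_mult)
    thus ?case unfolding prod.insert[OF insert.hyps] .
  qed (auto simp: poly_over_def coeff_1)
  moreover have "(\<Prod>s\<in>S. [:- (c * x s), c:]) = Polynomial.smult (c ^ card S) (root_poly x S)"
  proof -
    have "(\<Prod>s\<in>S. [:- (c * x s), c:]) = (\<Prod>s\<in>S. Polynomial.smult c [:- x s, 1:])" by simp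
    thus ?thesis by (simp only: prod_smult prod_constant root_poly_def)
  qed
  ultimately have "Polynomial.smult (c ^ card S) (root_poly x S) \<in> poly_over ?O" by simp
  from poly_overD[OF this, of m] show ?thesis by simp
qed

text \<open>
  If \<open>\<plusminus> V(S)\<^sup>2\<close> denotes the product of root differences, the claim says that \<open>V(S)\<close> is a denominator
  of the coefficients of \<open>B\<close> as soon as \<open>V(S - {j})\<close> is one for \<open>B(x\<^sub>j)\<close>. Squares are used because
  \<open>V(S - {j})\<^sup>2\<close> lies in \<open>K(x\<^sub>j)\<close>, so that it can be conjugated over \<open>K\<close> together with \<open>B(x\<^sub>j)\<close>.
\<close>

lemma algebraic_int_descent:
  fixes c :: "'a::field_char_0" and x :: "'i \<Rightarrow> 'a"
  defines "y \<equiv> \<lambda>r. c * x r"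
  assumes K: "is_subfield K" and S: "finite S" and inj: "inj_on x S" and j: "j \<in> S"
    and c: "c \<noteq> 0" "c \<in> K" "algebraic_int c"
    and y: "\<And>s. s \<in> S \<Longrightarrow> algebraic_int (y s)"
    and g: "root_poly x S \<in> poly_over K"
    and h: "is_minimal_poly K (x j) h"
    and B: "B \<in> poly_over K" "degree B < degree h"
    and int: "algebraic_int (diff_prod y (S - {j}) * (poly B (x j))\<^sup>2)"
  shows "algebraic_int (diff_prod y S * (coeff B m)\<^sup>2)"
proof -
  \<comment> \<open>The conjugates of \<open>x j\<close> over \<open>K\<close> are among the
    remaining roots; \<open>R\<close> indexes them.\<close>
  have "h dvd root_poly x S"
    by (intro is_minimal_poly_dvd[OF K h] g poly_root_poly_root S j)
  then obtain R where R: "R \<subseteq> S" "h = root_poly x R"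
    using monic_dvd_root_poly[OF S \<open>h dvd _\<close>] h by (auto simp: is_minimal_poly_def)
  have finR: "finite R" using R S finite_subset by auto
  have injR: "inj_on x R" using inj R inj_on_subset by blast

  define sgn where "sgn = (- 1 :: 'a) ^ (card S - 1)"
  have sgn2: "sgn * sgn = 1" by (simp add: sgn_def flip: power_add mult_2)
  define G where "G = (\<lambda>r. \<Prod>s\<in>S - {r}. y r - y s)"
  define F where "F = (\<lambda>r. \<Prod>s\<in>R - {r}. y r - y s)"
  have E_eq: "diff_prod y S = sgn * (G r)\<^sup>2 * diff_prod y (S - {r})" if "r \<in> S" for r
    unfolding sgn_def G_def by (rule diff_prod_remove[OF S that])
  have G_nz: "G r \<noteq> 0" if "r \<in> S" for r
    using that inj S c by (auto simp: G_def y_def inj_on_def)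
  have F_nz: "F r \<noteq> 0" if "r \<in> R" for r
    using that injR finR c by (auto simp: F_def y_def inj_on_def)

  define dS where "dS = Polynomial.smult (c ^ (card S - 1)) (pderiv (root_poly x S))"
  have dS: "dS \<in> poly_over K"
    unfolding dS_def by (intro poly_over_smult[OF K] subfield_power[OF K] poly_over_pderiv[OF K] g c)
  have poly_dS: "poly dS (x r) = G r" if "r \<in> S" for r
    unfolding dS_def G_def y_def by (rule prod_scaled_diffs[OF S that, symmetric])
  \<comment> \<open>\<open>W\<close> represents the inverse of \<open>G j\<close>; the identity
    \<open>W * dS = 1\<close> holds modulo \<open>h\<close> and so at every conjugate.\<close>
  obtain W where W: "W \<in> poly_over K" "poly W (x j) * poly dS (x j) = 1"
    using simple_extension_inverse[OF K h dS] poly_dS[OF j] G_nz[OF j] by auto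
  have W_G: "poly W (x r) * G r = 1" if "r \<in> R" for r
  proof -
    have "h dvd W * dS - 1"
      by (intro is_minimal_poly_dvd[OF K h] poly_over_diff[OF K] poly_over_mult[OF K] poly_over_one[OF K] W dS)
         (use W in simp)
    hence "poly (W * dS - 1) (x r) = 0"
      using poly_root_poly_root[OF finR that, of x] unfolding R(2)
      by (metis dvd_trans poly_eq_0_iff_dvd)
    thus ?thesis using poly_dS[of r] that R by auto
  qed

  have E: "diff_prod y S \<in> K"
    unfolding y_def by (rule diff_prod_in_subfield[OF K S g c(2)])
  \<comment> \<open>By \<open>E_eq\<close>, dividing by the square of \<open>G r\<close> strips
    \<open>r\<close> from \<open>diff_prod y S\<close>. So this one polynomial over \<open>K\<close>
    takes at every conjugate \<open>x r\<close> the value from the assumption \<open>int\<close>,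
    with \<open>r\<close> in place of \<open>j\<close>.\<close>
  define P where "P = [:sgn * diff_prod y S:] * (B * W)\<^sup>2"
  have P: "P \<in> poly_over K"
    unfolding P_def sgn_def
    by (intro poly_over_mult[OF K] poly_over_power[OF K] poly_over_const[OF K] subfield_mult[OF K]
        subfield_power[OF K] subfield_uminus[OF K] subfield_one[OF K] B W E)
  have jR: "j \<in> R"
  proof -
    have "poly (root_poly x R) (x j) = 0" using h R by (simp add: is_minimal_poly_def)
    then obtain s where "s \<in> R" "x j = x s" using finR by (auto simp: poly_root_poly)
    thus ?thesis using inj j R by (auto simp: inj_on_def)
  qed
  have poly_P: "poly P (x r) = diff_prod y (S - {r}) * (poly B (x r))\<^sup>2" if "r \<in> R" for r
  proof -
    have "r \<in> S" using that R by auto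
    have "poly P (x r) = (sgn * sgn) * diff_prod y (S - {r}) * (poly B (x r))\<^sup>2 * (poly W (x r) * G r)\<^sup>2"
      unfolding P_def E_eq[OF \<open>r \<in> S\<close>] by (simp add: power2_eq_square mult_ac)
    thus ?thesis by (simp add: sgn2 W_G that)
  qed
  have conj: "algebraic_int (diff_prod y (S - {r}) * (poly B (x r))\<^sup>2)" if "r \<in> R" for r
    unfolding poly_P[OF that, symmetric]
  proof (rule conjugate_algebraic_int[OF K h P])
    show "algebraic_int (poly P (x j))" using int by (simp add: poly_P jR)
    show "poly h (x r) = 0" unfolding R(2) by (rule poly_root_poly_root[OF finR that])
  qed

  \<comment> \<open>The weights of Lagrange interpolation, with the differences taken between the
    \<open>y\<close>. The remaining factor \<open>H\<close> of \<open>G r\<close> is integral, so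
    \<open>diff_prod y S\<close> clears the denominator of the square of \<open>u r\<close>.\<close>
  define u where "u = (\<lambda>r. poly B (x r) / F r)"
  have Eu2: "algebraic_int (diff_prod y S * (u r)\<^sup>2)" if r: "r \<in> R" for r
  proof -
    define H where "H = (\<Prod>s\<in>S - R. y r - y s)"
    have "S - {r} = (R - {r}) \<union> (S - R)" using R r by auto
    hence GF: "G r = F r * H"
      unfolding G_def F_def H_def using finR S by (simp only:) (rule prod.union_disjoint; auto)
    have "algebraic_int H"
      unfolding H_def using r R y by (intro algebraic_int_prod algebraic_int_diff) auto
    have "diff_prod y S * (u r)\<^sup>2 = sgn * (diff_prod y (S - {r}) * (poly B (x r))\<^sup>2) * H\<^sup>2"
      using E_eq[of r] r R F_nz[OF r] by (auto simp: u_def GF power_mult_distrib power_divide)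
    also have "algebraic_int \<dots>"
      unfolding sgn_def
      by (intro algebraic_int_add_mult conj r algebraic_int_power \<open>algebraic_int H\<close>) auto
    finally show ?thesis .
  qed
  \<comment> \<open>The mixed products are integral because their squares are products of the pure
    ones.\<close>
  have Euu: "algebraic_int (diff_prod y S * (u r * u s))" if "r \<in> R" "s \<in> R" for r s
  proof (rule algebraic_int_power2D)
    have "(diff_prod y S * (u r * u s))\<^sup>2 = (diff_prod y S * (u r)\<^sup>2) * (diff_prod y S * (u s)\<^sup>2)"
      by (simp add: power2_eq_square mult_ac)
    thus "algebraic_int ((diff_prod y S * (u r * u s))\<^sup>2)"
      using that by (simp only: algebraic_int_add_mult(2) Eu2)
  qed

  \<comment> \<open>The power of \<open>c\<close> by which \<open>F r\<close> differs from the plain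
    product of differences moves to the interpolation coefficient and makes it integral.\<close>
  define a where "a = (\<lambda>r. c ^ (card R - 1) * coeff (root_poly x (R - {r})) m)"
  have a: "algebraic_int (a r)" if "r \<in> R" for r
    using algebraic_int_coeff_scaled_root_poly[of c "R - {r}" x m] that c y R finR
    by (auto simp: a_def y_def)
  have "coeff B m = (\<Sum>r\<in>R. u r * a r)"
  proof -
    have "degree B < card R" using B R by (simp add: degree_root_poly)
    hence "coeff B m = coeff (\<Sum>r\<in>R. Polynomial.smult (poly B (x r) / (\<Prod>s\<in>R - {r}. x r - x s))
        (root_poly x (R - {r}))) m"
      by (intro arg_cong[where f = "\<lambda>p. coeff p m"] lagrange_interpolation finR injR)
    also have "\<dots> =
        (\<Sum>r\<in>R. poly B (x r) / (\<Prod>s\<in>R - {r}. x r - x s) * coeff (root_poly x (R - {r})) m)"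
      by (simp only: coeff_sum coeff_smult)
    also have "\<dots> = (\<Sum>r\<in>R. u r * a r)"
    proof (intro sum.cong refl)
      fix r assume "r \<in> R"
      hence "F r = c ^ (card R - 1) * (\<Prod>s\<in>R - {r}. x r - x s)"
        using finR by (simp add: F_def y_def prod.distrib flip: right_diff_distrib)
      thus "poly B (x r) / (\<Prod>s\<in>R - {r}. x r - x s) * coeff (root_poly x (R - {r})) m = u r * a r"
        using c by (simp add: u_def a_def)
    qed
    finally show ?thesis .
  qed
  hence "diff_prod y S * (coeff B m)\<^sup>2 =
      (\<Sum>r\<in>R. \<Sum>s\<in>R. (diff_prod y S * (u r * u s)) * (a r * a s))"
    by (simp add: power2_eq_square sum_product sum_distrib_left mult_ac)
  also have "algebraic_int \<dots>"
    by (intro algebraic_int_sum algebraic_int_add_mult Euu a)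
  finally show ?thesis .
qed

subsection \<open>The monomial basis of the tower\<close>

text \<open>The sum occurring in \<open>tower_coeff\<close> once the last index is fixed. Indices
  start at 1, so exponents run from \<open>tower_deg x l - 1\<close> down to 0.\<close>

definition tower_sum :: "(nat \<Rightarrow> 'a::field_char_0) \<Rightarrow> nat \<Rightarrow> ((nat \<Rightarrow> nat) \<Rightarrow> rat) \<Rightarrow> 'a" where
  "tower_sum x j b =
     (\<Sum>k\<in>tower_indices x j. of_rat (b k) * (\<Prod>l=1..j. x l ^ (tower_deg x l - k l)))"

lemma tower_sum_cong:
  "(\<And>k. k \<in> tower_indices x j \<Longrightarrow> b k = b' k) \<Longrightarrow> tower_sum x j b = tower_sum x j b'"
  by (simp add: tower_sum_def)

lemma tower_sum_scale: "of_rat q * tower_sum x j b = tower_sum x j (\<lambda>k. q * b k)"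
  by (simp add: tower_sum_def sum_distrib_left of_rat_mult mult.assoc)

lemma tower_indices_Suc:
  "tower_indices x (Suc j) =
     (\<lambda>(m, k). k(Suc j := m)) ` ({1..tower_deg x (Suc j)} \<times> tower_indices x j)"
proof -
  have "{1..Suc j} = insert (Suc j) {1..j}" by auto
  thus ?thesis unfolding tower_indices_def by (simp only: PiE_insert_eq)
qed

text \<open>Glues the expansions of all the coefficients of a polynomial over level \<open>j\<close>
  into a single family. The witness reads off the last index and resets it to
  \<open>undefined\<close>, its value in an extensional tuple of level \<open>j\<close>.\<close>

lemma tower_indices_extend: "\<exists>b. \<forall>m. \<forall>k\<in>tower_indices x j. b (k(Suc j := m)) = bb m k"
proof (intro exI[of _ "\<lambda>k. bb (k (Suc j)) (k(Suc j := undefined))"] allI ballI)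
  fix m k assume "k \<in> tower_indices x j"
  hence "k (Suc j) = undefined" by (auto simp: tower_indices_def PiE_def extensional_def)
  hence "k(Suc j := undefined) = k" by (rule fun_upd_idem)
  thus "bb ((k(Suc j := m)) (Suc j)) ((k(Suc j := m))(Suc j := undefined)) = bb m k" by simp
qed

lemma tower_sum_Suc:
  "tower_sum x (Suc j) b = (\<Sum>m=1..tower_deg x (Suc j).
     tower_sum x j (\<lambda>k. b (k(Suc j := m))) * x (Suc j) ^ (tower_deg x (Suc j) - m))"
proof -
  let ?d = "tower_deg x (Suc j)"
  have inj: "inj_on (\<lambda>(m, k). k(Suc j := m)) ({1..?d} \<times> tower_indices x j)"
    unfolding tower_indices_def by (rule inj_combinator) auto
  have mon: "(\<Prod>l=1..Suc j. x l ^ (tower_deg x l - (k(Suc j := m)) l)) =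
      (\<Prod>l=1..j. x l ^ (tower_deg x l - k l)) * x (Suc j) ^ (?d - m)" for k m
    by simp
  have "tower_sum x (Suc j) b = (\<Sum>(m, k)\<in>{1..?d} \<times> tower_indices x j.
      of_rat (b (k(Suc j := m))) * ((\<Prod>l=1..j. x l ^ (tower_deg x l - k l)) * x (Suc j) ^ (?d - m)))"
    unfolding tower_sum_def tower_indices_Suc
    by (subst sum.reindex[OF inj], rule sum.cong[OF refl]) (simp only: comp_def case_prod_beta mon)
  also have "\<dots> = (\<Sum>m=1..?d. tower_sum x j (\<lambda>k. b (k(Suc j := m))) * x (Suc j) ^ (?d - m))"
    by (simp add: tower_sum_def sum_distrib_right mult.assoc flip: sum.cartesian_product)
  finally show ?thesis .
qed

text \<open>Irreducibility of the given polynomial enters the tower argument in the form of distinct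
  roots.\<close>

locale root_tower =
  fixes x :: "nat \<Rightarrow> 'a::field_char_0" and n :: nat
  assumes inj: "inj_on x {1..n}" and rational: "root_poly x {1..n} \<in> poly_over \<rat>"
begin

abbreviation "K \<equiv> tower_field x"

lemma K: "is_subfield (K j)"
  unfolding tower_field_def by (rule is_subfield_gen_field)

lemma K_0: "K 0 = \<rat>"
  by (simp add: tower_field_def gen_field_empty)

lemma root_poly_over: "root_poly x {1..n} \<in> poly_over (K j)"
proof -
  have "(\<rat> :: 'a set) \<subseteq> K j" by (auto simp: Rats_def intro: subfield_of_rat[OF K])
  thus ?thesis using rational poly_over_mono by blast
qed

lemma minimal_tower_poly:
  assumes "j < n"
  shows "is_minimal_poly (K j) (x (Suc j)) (tower_poly x (Suc j))"
  using assms unfolding tower_poly_def diff_Suc_1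
  by (intro is_minimal_poly_minimal_poly_over[OF K root_poly_over] root_poly_nonzero
      poly_root_poly_root) auto

lemma tower_poly_over: "j < n \<Longrightarrow> tower_poly x (Suc j) \<in> poly_over (K j)"
  using minimal_tower_poly by (auto simp: is_minimal_poly_def)

lemma tower_deg_pos: "j < n \<Longrightarrow> tower_deg x (Suc j) > 0"
  unfolding tower_deg_def by (rule is_minimal_poly_degree_pos[OF minimal_tower_poly])

lemma K_Suc: "j < n \<Longrightarrow> K (Suc j) = (\<lambda>p. poly p (x (Suc j))) ` poly_over (K j)"
  by (rule tower_field_Suc[OF minimal_tower_poly])

text \<open>Each step splits off one linear factor, and polynomial division stays over the larger
  field.\<close>

lemma remaining_roots_over: "j \<le> n \<Longrightarrow> root_poly x {Suc j..n} \<in> poly_over (K j)"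
proof (induction j)
  case 0
  thus ?case using rational by (simp add: K_0)
next
  case (Suc j)
  have "K j \<subseteq> K (Suc j)"
    unfolding tower_field_def by (intro gen_field_mono image_mono) auto
  moreover have "root_poly x {Suc j..n} \<in> poly_over (K j)"
    using Suc.IH Suc.prems by simp
  ultimately have g: "root_poly x {Suc j..n} \<in> poly_over (K (Suc j))"
    using poly_over_mono by blast
  have "x (Suc j) \<in> K (Suc j)"
    unfolding tower_field_def using gen_field_superset[of "x ` {1..Suc j}"] by auto
  hence lin: "[:- x (Suc j), 1:] \<in> poly_over (K (Suc j))"
    by (intro poly_over_pCons[OF K] poly_over_zero[OF K] subfield_one[OF K] subfield_uminus[OF K])
  have "{Suc j..n} - {Suc j} = {Suc (Suc j)..n}" by auto
  hence "root_poly x {Suc j..n} = [:- x (Suc j), 1:] * root_poly x {Suc (Suc j)..n}"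
    using root_poly_remove[of "{Suc j..n}" "Suc j" x] Suc.prems by simp
  hence "root_poly x {Suc (Suc j)..n} = root_poly x {Suc j..n} div [:- x (Suc j), 1:]"
    by (metis nonzero_mult_div_cancel_left pCons_eq_0_iff zero_neq_one)
  thus ?case using poly_over_division(1)[OF K g lin] by simp
qed

lemma tower_sum_in: "j \<le> n \<Longrightarrow> tower_sum x j b \<in> K j"
  unfolding tower_sum_def
proof (intro subfield_sum[OF K] subfield_mult[OF K] subfield_of_rat[OF K] subfield_prod[OF K]
    subfield_power[OF K])
  fix l assume "l \<in> {1..j}"
  thus "x l \<in> K j"
    unfolding tower_field_def using gen_field_superset[of "x ` {1..j}"] by auto
qed

lemma sum_flip: "(\<Sum>m=1..d. g m * t ^ (d - m)) = (\<Sum>e<d. g (d - e) * (t :: 'a) ^ e)"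
  by (rule sum.reindex_bij_witness[of _ "\<lambda>e. d - e" "\<lambda>m. d - m"]) auto

text \<open>Collects the powers of the last root. This is the passage from families of rationals to
  polynomials over \<open>K j\<close>, to which minimality and the descent apply.\<close>

lemma tower_sum_as_poly:
  assumes "j < n"
  shows "\<exists>B\<in>poly_over (K j). degree B < tower_deg x (Suc j) \<and>
    poly B (x (Suc j)) = tower_sum x (Suc j) b \<and>
    (\<forall>m\<in>{1..tower_deg x (Suc j)}.
       coeff B (tower_deg x (Suc j) - m) = tower_sum x j (\<lambda>k. b (k(Suc j := m))))"
proof -
  let ?d = "tower_deg x (Suc j)"
  define c where "c = (\<lambda>m. tower_sum x j (\<lambda>k. b (k(Suc j := m))))"
  define B where "B = (\<Sum>e<?d. monom (c (?d - e)) e)"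
  have coeff: "coeff B e = (if e < ?d then c (?d - e) else 0)" for e
    by (simp add: B_def coeff_sum)
  show ?thesis
  proof (intro bexI conjI ballI)
    show "B \<in> poly_over (K j)"
      unfolding B_def c_def using assms
      by (intro poly_over_sum[OF K] poly_over_monom[OF K] tower_sum_in) auto
    have "degree B \<le> ?d - 1"
      unfolding B_def by (intro degree_sum_le order.trans[OF degree_monom_le]) auto
    thus "degree B < ?d" using tower_deg_pos[OF assms] by simp
    show "poly B (x (Suc j)) = tower_sum x (Suc j) b"
      unfolding tower_sum_Suc sum_flip by (simp add: B_def c_def poly_sum poly_monom)
    show "coeff B (?d - m) = tower_sum x j (\<lambda>k. b (k(Suc j := m)))" if "m \<in> {1..?d}" for m
      using that by (simp add: coeff c_def)
  qed
qed

text \<open>A polynomial in the last root representing the element is reduced modulo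
  \<open>tower_poly\<close>, and its coefficients are expanded by the induction hypothesis.\<close>

lemma tower_sum_surj: "j \<le> n \<Longrightarrow> \<beta> \<in> K j \<Longrightarrow> \<exists>b. \<beta> = tower_sum x j b"
proof (induction j arbitrary: \<beta>)
  case 0
  then obtain q where q: "\<beta> = of_rat q" by (auto simp: K_0 Rats_def)
  have "tower_indices x 0 = {\<lambda>_. undefined}" by (simp add: tower_indices_def)
  thus ?case using q by (intro exI[of _ "\<lambda>_. q"]) (simp add: tower_sum_def)
next
  case (Suc j)
  let ?d = "tower_deg x (Suc j)" and ?h = "tower_poly x (Suc j)"
  have j: "j < n" using Suc.prems(1) by simp
  obtain p where p: "p \<in> poly_over (K j)" "\<beta> = poly p (x (Suc j))"
    using K_Suc[OF j] Suc.prems by auto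
  define r where "r = p mod ?h"
  have h: "?h \<noteq> 0" "poly ?h (x (Suc j)) = 0"
    using minimal_tower_poly[OF j] by (auto simp: is_minimal_poly_def)
  have r: "r \<in> poly_over (K j)"
    unfolding r_def by (intro poly_over_division[OF K] p tower_poly_over j)
  have "r = 0 \<or> degree r < ?d"
    using degree_mod_less[OF h(1), of p] by (simp add: r_def tower_deg_def)
  hence deg: "degree r < ?d" using tower_deg_pos[OF j] by auto
  have "\<forall>m. \<exists>b. coeff r (?d - m) = tower_sum x j b"
    using Suc.IH j poly_overD[OF r] by auto
  then obtain bb where bb: "\<And>m. coeff r (?d - m) = tower_sum x j (bb m)" by metis
  obtain b where b: "\<And>m k. k \<in> tower_indices x j \<Longrightarrow> b (k(Suc j := m)) = bb m k"
    using tower_indices_extend[of x j bb] by blast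
  have "tower_sum x (Suc j) b = (\<Sum>m=1..?d. coeff r (?d - m) * x (Suc j) ^ (?d - m))"
    unfolding tower_sum_Suc bb by (intro sum.cong arg_cong2[where f = "(*)"] refl tower_sum_cong b)
  also have "\<dots> = (\<Sum>e<?d. coeff r e * x (Suc j) ^ e)"
    unfolding sum_flip by (intro sum.cong) auto
  also have "\<dots> = poly r (x (Suc j))"
    unfolding poly_altdef using deg
    by (intro sum.mono_neutral_right) (auto simp: coeff_eq_0)
  also have "\<dots> = \<beta>" by (simp add: r_def poly_mod h p)
  finally show ?case by metis
qed

text \<open>Two polynomials of degree below that of the minimal polynomial and with the same value
  at the last root coincide; comparing coefficients leads one level down.\<close>

lemma tower_sum_inj:
  "j \<le> n \<Longrightarrow> tower_sum x j b = tower_sum x j b' \<Longrightarrow> \<forall>k\<in>tower_indices x j. b k = b' k"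
proof (induction j arbitrary: b b')
  case 0
  have "tower_indices x 0 = {\<lambda>_. undefined}" by (simp add: tower_indices_def)
  thus ?case using 0 by (simp add: tower_sum_def)
next
  case (Suc j)
  let ?d = "tower_deg x (Suc j)"
  have j: "j < n" using Suc.prems(1) by simp
  show ?case
  proof
    fix k assume "k \<in> tower_indices x (Suc j)"
    then obtain k0 m where k: "k0 \<in> tower_indices x j" "m \<in> {1..?d}" "k = k0(Suc j := m)"
      unfolding tower_indices_Suc by auto
    obtain B where B: "B \<in> poly_over (K j)" "degree B < ?d" "poly B (x (Suc j)) = tower_sum x (Suc j) b"
      "coeff B (?d - m) = tower_sum x j (\<lambda>k. b (k(Suc j := m)))"
      using tower_sum_as_poly[OF j, of b] k(2) by blast
    obtain B' where B': "B' \<in> poly_over (K j)" "degree B' < ?d" "poly B' (x (Suc j)) = tower_sum x (Suc j) b'"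
      "coeff B' (?d - m) = tower_sum x j (\<lambda>k. b' (k(Suc j := m)))"
      using tower_sum_as_poly[OF j, of b'] k(2) by blast
    have "B = B'"
    proof (rule ccontr)
      assume "B \<noteq> B'"
      hence "B - B' \<noteq> 0" by simp
      moreover have "poly (B - B') (x (Suc j)) = 0" using B B' Suc.prems(2) by simp
      moreover have "B - B' \<in> poly_over (K j)" by (intro poly_over_diff[OF K] B B')
      ultimately have "?d \<le> degree (B - B')"
        using minimal_tower_poly[OF j] unfolding is_minimal_poly_def tower_deg_def by blast
      moreover have "degree (B - B') < ?d" using B B' by (intro degree_diff_less)
      ultimately show False by simp
    qed
    hence "tower_sum x j (\<lambda>k. b (k(Suc j := m))) = tower_sum x j (\<lambda>k. b' (k(Suc j := m)))"
      using B B' by simp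
    hence "b (k0(Suc j := m)) = b' (k0(Suc j := m))"
      using j k(1) Suc.IH[of "\<lambda>k. b (k(Suc j := m))" "\<lambda>k. b' (k(Suc j := m))"] by simp
    thus "b k = b' k" by (simp only: k(3))
  qed
qed

text \<open>Iterates \<open>algebraic_int_descent\<close>: in the step \<open>S\<close> is
  \<open>{Suc j..n}\<close> and the coefficients of \<open>B\<close> are tower sums of level
  \<open>j\<close>. At level 0 the sum is the rational coefficient itself.\<close>

lemma tower_sum_integral:
  fixes c :: rat
  defines "y \<equiv> \<lambda>r. of_rat c * x r"
  assumes c: "c \<noteq> 0" "algebraic_int (of_rat c :: 'a)"
    and y: "\<And>s. s \<in> {1..n} \<Longrightarrow> algebraic_int (y s)"
  shows "j \<le> n \<Longrightarrow> algebraic_int (diff_prod y {Suc j..n} * (tower_sum x j b)\<^sup>2) \<Longrightarrow>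
    \<forall>k\<in>tower_indices x j. algebraic_int (diff_prod y {1..n} * (of_rat (b k))\<^sup>2)"
proof (induction j arbitrary: b)
  case 0
  have "tower_indices x 0 = {\<lambda>_. undefined}" by (simp add: tower_indices_def)
  thus ?case using 0 by (simp add: tower_sum_def)
next
  case (Suc j)
  let ?d = "tower_deg x (Suc j)" and ?S = "{Suc j..n}"
  have j: "j < n" using Suc.prems(1) by simp
  show ?case
  proof
    fix k assume "k \<in> tower_indices x (Suc j)"
    then obtain k0 m where k: "k0 \<in> tower_indices x j" "m \<in> {1..?d}" "k = k0(Suc j := m)"
      unfolding tower_indices_Suc by auto
    obtain B where B: "B \<in> poly_over (K j)" "degree B < ?d" "poly B (x (Suc j)) = tower_sum x (Suc j) b"
      "coeff B (?d - m) = tower_sum x j (\<lambda>k. b (k(Suc j := m)))"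
      using tower_sum_as_poly[OF j, of b] k(2) by blast
    have S: "?S - {Suc j} = {Suc (Suc j)..n}" by auto
    have "algebraic_int (diff_prod y ?S * (coeff B (?d - m))\<^sup>2)"
      unfolding y_def
    proof (rule algebraic_int_descent[OF K, where j = "Suc j" and h = "tower_poly x (Suc j)"])
      show "inj_on x ?S" using inj by (rule inj_on_subset) auto
      show "root_poly x ?S \<in> poly_over (K j)" using j by (intro remaining_roots_over) auto
      show "is_minimal_poly (K j) (x (Suc j)) (tower_poly x (Suc j))" by (rule minimal_tower_poly[OF j])
      show "degree B < degree (tower_poly x (Suc j))" using B by (simp add: tower_deg_def)
      show "algebraic_int (diff_prod (\<lambda>r. of_rat c * x r) (?S - {Suc j}) * (poly B (x (Suc j)))\<^sup>2)"
        using Suc.prems(2) by (simp only: S B y_def)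
      show "algebraic_int (of_rat c * x s)" if "s \<in> ?S" for s
        using y[of s] that by (simp add: y_def)
    qed (use c B j in \<open>auto intro: subfield_of_rat[OF K]\<close>)
    hence "algebraic_int (diff_prod y {Suc j..n} * (tower_sum x j (\<lambda>k. b (k(Suc j := m))))\<^sup>2)"
      by (simp only: B)
    hence "algebraic_int (diff_prod y {1..n} * (of_rat (b (k0(Suc j := m))))\<^sup>2)"
      using j k(1) Suc.IH[of "\<lambda>k. b (k(Suc j := m))"] by simp
    thus "algebraic_int (diff_prod y {1..n} * (of_rat (b k))\<^sup>2)" by (simp only: k(3))
  qed
qed

end

section \<open>The rational coefficients of the tower polynomials\<close>

context root_tower
begin

text \<open>Existence for the definite description \<open>tower_coeff\<close> comes from
  \<open>tower_sum_surj\<close>, uniqueness from \<open>tower_sum_inj\<close>.\<close>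

lemma tower_coeff_spec:
  assumes j: "j < n" and m: "m \<in> {1..tower_deg x (Suc j)}"
  shows "coeff (tower_poly x (Suc j)) (tower_deg x (Suc j) - m) =
    tower_sum x j (\<lambda>k. tower_coeff x (Suc j) (k(Suc j := m)))"
proof -
  let ?d = "tower_deg x (Suc j)" and ?h = "tower_poly x (Suc j)" and ?I = "tower_indices x (Suc j)"
  define P where "P = (\<lambda>b. b \<in> extensional ?I \<and>
    (\<forall>m\<in>{1..?d}. coeff ?h (?d - m) = tower_sum x j (\<lambda>k. b (k(Suc j := m)))))"
  have "\<forall>m. \<exists>b. coeff ?h (?d - m) = tower_sum x j b"
    using j by (intro allI tower_sum_surj poly_overD tower_poly_over) auto
  then obtain bb where bb: "\<And>m. coeff ?h (?d - m) = tower_sum x j (bb m)" by metis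
  obtain b where b: "\<And>m k. k \<in> tower_indices x j \<Longrightarrow> b (k(Suc j := m)) = bb m k"
    using tower_indices_extend[of x j bb] by blast
  have "P (restrict b ?I)"
    unfolding P_def
  proof (intro conjI ballI)
    fix m assume "m \<in> {1..?d}"
    hence "k(Suc j := m) \<in> ?I" if "k \<in> tower_indices x j" for k
      unfolding tower_indices_Suc using that by force
    hence "tower_sum x j (\<lambda>k. restrict b ?I (k(Suc j := m))) = tower_sum x j (bb m)"
      using b by (intro tower_sum_cong) simp
    thus "coeff ?h (?d - m) = tower_sum x j (\<lambda>k. restrict b ?I (k(Suc j := m)))"
      using bb by simp
  qed simp
  moreover have "b1 = b2" if b1: "P b1" and b2: "P b2" for b1 b2
  proof (rule extensionalityI)
    show "b1 \<in> extensional ?I" "b2 \<in> extensional ?I" using that by (auto simp: P_def)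
    fix k assume "k \<in> ?I"
    then obtain k0 m where k: "k0 \<in> tower_indices x j" "m \<in> {1..?d}" "k = k0(Suc j := m)"
      unfolding tower_indices_Suc by auto
    have "tower_sum x j (\<lambda>k. b1 (k(Suc j := m))) = tower_sum x j (\<lambda>k. b2 (k(Suc j := m)))"
      using b1 b2 k(2) unfolding P_def by metis
    from tower_sum_inj[OF _ this] j k(1) have "b1 (k0(Suc j := m)) = b2 (k0(Suc j := m))" by simp
    thus "b1 k = b2 k" by (simp only: k(3))
  qed
  ultimately have "P (THE b. P b)" by (intro theI[of P])
  moreover have "tower_coeff x (Suc j) = (THE b. P b)"
    unfolding tower_coeff_def P_def tower_sum_def diff_Suc_1 by (rule refl)
  ultimately show ?thesis using m by (simp add: P_def)
qed

lemma Ints_if_of_rat_Ints: "(of_rat q :: 'a) \<in> \<int> \<Longrightarrow> q \<in> \<int>"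
  by (elim Ints_cases) (metis Ints_of_int of_rat_eq_iff of_rat_of_int_eq)

text \<open>
  The exponents \<open>n (n - 1)\<close> and \<open>1\<close> of \<open>\<gamma>\<close> and of the discriminant suffice for every \<open>i\<close>; the factor
  \<open>\<lceil>i/2\<rceil>\<close> in the theorem only adds further integral factors.
\<close>

lemma tower_coeff_integral:
  fixes \<gamma> :: int
  assumes \<gamma>: "\<gamma> \<noteq> 0" and y: "\<And>s. s \<in> {1..n} \<Longrightarrow> algebraic_int (of_int \<gamma> * x s)"
  obtains D :: int where "of_int D = of_int \<gamma> ^ (n * (n - 1)) * root_disc n x"
    "\<And>j k. j < n \<Longrightarrow> k \<in> tower_indices x (Suc j) \<Longrightarrow>
       of_int D * of_int \<gamma> ^ tower_deg x (Suc j) * tower_coeff x (Suc j) k \<in> \<int>"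
proof -
  define y where "y = (\<lambda>r. of_int \<gamma> * x r)"
  have y_int: "algebraic_int (y s)" if "s \<in> {1..n}" for s
    using assms(2)[OF that] by (simp add: y_def)
  define E where "E = of_int \<gamma> ^ (n * (n - 1)) * root_disc n x"
  obtain e where e: "diff_prod y {1..n} = (- 1) ^ e * E"
    using diff_prod_scaled_eq_root_disc[of "of_int \<gamma>" x n] unfolding y_def E_def by blast
  have sgn: "(- 1 :: 'a) ^ e * (- 1) ^ e = 1" by (simp flip: power_add mult_2)
  have E: "E = (- 1) ^ e * diff_prod y {1..n}"
    unfolding e mult.assoc[symmetric] sgn by simp
  \<comment> \<open>\<open>E\<close> is integral as a product of integral differences and rational
    by symmetry, hence an integer \<open>D\<close>.\<close>
  have "algebraic_int E"
    unfolding E diff_prod_def using y_int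
    by (intro algebraic_int_add_mult algebraic_int_power algebraic_int_prod algebraic_int_diff) auto
  moreover have "E \<in> \<rat>"
  proof -
    have "diff_prod y {1..n} \<in> \<rat>"
      unfolding y_def by (rule diff_prod_in_subfield[OF is_subfield_Rats _ rational]) auto
    thus ?thesis unfolding E by simp
  qed
  ultimately have "E \<in> \<int>" by (rule rational_algebraic_int_is_int)
  then obtain D where D: "E = of_int D" by (elim Ints_cases)
  show ?thesis
  proof (rule that)
    show "of_int D = of_int \<gamma> ^ (n * (n - 1)) * root_disc n x"
      using D by (simp add: E_def)
    fix j k assume j: "j < n" and k: "k \<in> tower_indices x (Suc j)"
    let ?d = "tower_deg x (Suc j)" and ?h = "tower_poly x (Suc j)"
    let ?b = "tower_coeff x (Suc j)"
    obtain k0 m where k0: "k0 \<in> tower_indices x j" "m \<in> {1..?d}" "k = k0(Suc j := m)"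
      using k unfolding tower_indices_Suc by auto
    have "?h dvd root_poly x {Suc j..n}"
      using j by (intro is_minimal_poly_dvd[OF K minimal_tower_poly[OF j]] remaining_roots_over
          poly_root_poly_root) auto
    then obtain R where R: "R \<subseteq> {Suc j..n}" "?h = root_poly x R"
      using monic_dvd_root_poly[OF _ \<open>?h dvd _\<close>] minimal_tower_poly[OF j]
      by (auto simp: is_minimal_poly_def)
    \<comment> \<open>\<open>?h\<close> is a product of \<open>?d\<close> linear factors over
      remaining roots, so one \<gamma> per factor makes its coefficients integral.\<close>
    define \<beta> where "\<beta> = of_int \<gamma> ^ ?d * coeff ?h (?d - m)"
    have d: "?d = card R" by (simp add: tower_deg_def R degree_root_poly)
    have "algebraic_int \<beta>"
      unfolding \<beta>_def d R(2)
      by (rule algebraic_int_coeff_scaled_root_poly) (use R y_int in \<open>auto simp: y_def\<close>)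
    moreover have "algebraic_int (diff_prod y {Suc j..n})"
      unfolding diff_prod_def using y_int
      by (intro algebraic_int_prod algebraic_int_diff) auto
    ultimately have *: "algebraic_int (diff_prod y {Suc j..n} * \<beta>\<^sup>2)"
      by (intro algebraic_int_add_mult algebraic_int_power)
    define b where "b = (\<lambda>k. of_int \<gamma> ^ ?d * ?b (k(Suc j := m)))"
    have "\<beta> = tower_sum x j b"
      unfolding \<beta>_def tower_coeff_spec[OF j k0(2)] b_def tower_sum_scale[symmetric]
      by (simp add: of_rat_power)
    hence "algebraic_int (diff_prod y {1..n} * (of_rat (b k0))\<^sup>2)"
      using tower_sum_integral[of "of_int \<gamma>" j b] * j k0(1) \<gamma> y_int by (simp add: y_def)
    hence "algebraic_int ((- 1) ^ e * (diff_prod y {1..n} * (of_rat (b k0))\<^sup>2))"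
      by (rule algebraic_int_add_mult(2)[OF algebraic_int_power, rotated]) auto
    hence "algebraic_int (E * (of_rat (b k0))\<^sup>2)" by (simp add: E mult.assoc)
    \<comment> \<open>A second factor \<open>E\<close> completes a square; its root
      \<open>D * b k0\<close> is then integral and rational.\<close>
    hence "algebraic_int (E * (E * (of_rat (b k0))\<^sup>2))"
      by (rule algebraic_int_add_mult(2)[OF \<open>algebraic_int E\<close>])
    also have "E * (E * (of_rat (b k0))\<^sup>2) = (of_rat (of_int D * b k0))\<^sup>2"
      by (simp add: D of_rat_mult power2_eq_square)
    finally have "algebraic_int (of_rat (of_int D * b k0) :: 'a)" by (rule algebraic_int_power2D)
    hence "(of_rat (of_int D * b k0) :: 'a) \<in> \<int>" by (rule rational_algebraic_int_is_int) simp
    hence "of_int D * b k0 \<in> \<int>" by (rule Ints_if_of_rat_Ints)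
    thus "of_int D * of_int \<gamma> ^ ?d * ?b k \<in> \<int>"
      by (simp add: b_def k0(3) mult.assoc)
  qed
qed

end

subsection \<open>Integral multivariate polynomials\<close>

lemma int_mpols_zero: "0 \<in> int_mpols i"
  by (simp add: int_mpols_def)

lemma int_mpols_add: "p \<in> int_mpols i \<Longrightarrow> q \<in> int_mpols i \<Longrightarrow> p + q \<in> int_mpols i"
  using Poly_Mapping.keys_add[of p q] by (fastforce simp: int_mpols_def lookup_add)

lemma int_mpols_sum: "(\<And>s. s \<in> S \<Longrightarrow> g s \<in> int_mpols i) \<Longrightarrow> sum g S \<in> int_mpols i"
  by (induction S rule: infinite_finite_induct) (auto intro: int_mpols_zero int_mpols_add)

lemma int_mpols_single:
  "a \<in> \<int> \<Longrightarrow> Poly_Mapping.keys t \<subseteq> {1..i} \<Longrightarrow> Poly_Mapping.single t a \<in> int_mpols i"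
  by (auto simp: int_mpols_def lookup_single when_def)

lemma mp_var_power:
  "(mp_var j :: 'c::comm_ring_1 mpol) ^ e = Poly_Mapping.single (Poly_Mapping.single j e) 1"
  by (induction e) (simp_all add: mp_var_def mult_single flip: single_add)

lemma mp_monomial:
  fixes S :: "nat set"
  assumes "finite S"
  shows "\<exists>t. (\<Prod>j\<in>S. (mp_var j :: 'c::comm_ring_1 mpol) ^ e j) = Poly_Mapping.single t 1 \<and>
    Poly_Mapping.keys t \<subseteq> S"
  using assms
proof (induction S rule: finite_induct)
  case empty
  show ?case by (intro exI[of _ 0]) simp
next
  case (insert j S)
  then obtain t where t: "(\<Prod>j\<in>S. (mp_var j :: 'c mpol) ^ e j) = Poly_Mapping.single t 1"
    "Poly_Mapping.keys t \<subseteq> S" by blast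
  have "(\<Prod>j\<in>insert j S. (mp_var j :: 'c mpol) ^ e j) =
      Poly_Mapping.single (Poly_Mapping.single j (e j) + t) 1"
    unfolding prod.insert[OF insert.hyps] t(1) unfolding mp_var_power mult_single by simp
  moreover have "Poly_Mapping.keys (Poly_Mapping.single j (e j) + t) \<subseteq> insert j S"
    using Poly_Mapping.keys_add[of "Poly_Mapping.single j (e j)" t] t(2) by (auto split: if_splits)
  ultimately show ?case by blast
qed

text \<open>The leading term acquires the integer \<open>a\<close> itself as coefficient; the other
  terms are monomials in the first \<open>i\<close> variables by \<open>mp_monomial\<close>.\<close>

lemma scaled_tower_hat_in_int_mpols:
  assumes "i > 0" "\<And>k. k \<in> tower_indices x i \<Longrightarrow> of_int a * tower_coeff x i k \<in> \<int>"
  shows "of_int a * tower_hat x i \<in> int_mpols i"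
proof -
  have a: "(of_int a :: rat mpol) = Poly_Mapping.single 0 (of_int a)" by simp
  have "(of_int a :: rat mpol) * mp_var i ^ tower_deg x i \<in> int_mpols i"
    unfolding mp_var_power a mult_single using assms(1)
    by (intro int_mpols_single) (auto split: if_splits)
  moreover have "of_int a * (mp_const (tower_coeff x i k) *
      (\<Prod>j=1..i. mp_var j ^ (tower_deg x j - k j))) \<in> int_mpols i" if k: "k \<in> tower_indices x i" for k
  proof -
    obtain t where t: "(\<Prod>j=1..i. (mp_var j :: rat mpol) ^ (tower_deg x j - k j)) = Poly_Mapping.single t 1"
      "Poly_Mapping.keys t \<subseteq> {1..i}" 
      using mp_monomial[where 'c = rat, of "{1..i}" "\<lambda>j. tower_deg x j - k j"] by auto
    show ?thesis
      unfolding t(1) mp_const_def a mult_single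
      using assms(2)[OF k] t(2) by (intro int_mpols_single) auto
  qed
  ultimately show ?thesis
    unfolding tower_hat_def distrib_left sum_distrib_left by (intro int_mpols_add int_mpols_sum)
qed

text \<open>A repeated root would also be a zero of the derivative. A rational polynomial
  \<open>q\<close> of least degree vanishing there divides \<open>f\<close>; by irreducibility
  \<open>f\<close> divides \<open>q\<close> or \<open>q\<close> is constant. The first contradicts
  the smaller degree of the derivative, the second that \<open>q\<close> is nonzero with a
  zero.\<close>

lemma inj_on_roots_irreducible:
  fixes f :: "rat poly" and x :: "'i \<Rightarrow> 'a::field_char_0"
  assumes f: "irreducible f" and S: "finite S" and roots: "map_poly of_rat f = root_poly x S"
  shows "inj_on x S"
proof (rule inj_onI, rule ccontr)
  fix r s assume rs: "r \<in> S" "s \<in> S" "x r = x s" "r \<noteq> s"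
  define ev where "ev = (\<lambda>q. poly (map_poly (of_rat :: rat \<Rightarrow> 'a) q) (x r))"
  interpret h: map_poly_comm_ring_hom "of_rat :: rat \<Rightarrow> 'a" ..
  have ev_add: "ev (p + q) = ev p + ev q" and ev_mult: "ev (p * q) = ev p * ev q" for p q
    by (simp_all add: ev_def hom_distribs)
  have "degree f \<noteq> 0"
    using f by (auto simp: irreducible_def is_unit_iff_degree)
  hence pd: "pderiv f \<noteq> 0" by (simp add: pderiv_eq_0_iff)
  have "ev f = 0"
    unfolding ev_def roots by (rule poly_root_poly_root[OF S rs(1)])
  have "map_poly (of_rat :: rat \<Rightarrow> 'a) (pderiv f) = pderiv (map_poly of_rat f)"
    by (intro poly_eqI) (simp add: coeff_map_poly coeff_pderiv of_rat_mult of_rat_add)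
  hence "ev (pderiv f) = (\<Prod>u\<in>S - {r}. x r - x u)"
    unfolding ev_def roots by (simp add: poly_pderiv_root_poly[OF S rs(1)])
  \<comment> \<open>The factor with \<open>u = s\<close> vanishes.\<close>
  also have "\<dots> = 0" using rs S by (auto intro!: prod_zero)
  finally have "ev (pderiv f) = 0" .
  then obtain q where q: "q \<noteq> 0" "ev q = 0"
      and least: "\<And>p. p \<noteq> 0 \<Longrightarrow> ev p = 0 \<Longrightarrow> degree q \<le> degree p"
    using ex_has_least_nat[of "\<lambda>q. q \<noteq> 0 \<and> ev q = 0" "pderiv f" degree] pd by blast
  have "ev (f mod q) = 0"
    using \<open>ev f = 0\<close> ev_add[of "f div q * q" "f mod q"] by (simp add: ev_mult q)
  hence "q dvd f"
    using least[of "f mod q"] degree_mod_less'[OF q(1), of f] by (force simp: dvd_eq_mod_eq_0)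
  hence "f dvd q \<or> is_unit q" using irreducibleD'[OF f] by blast
  thus False
  proof
    assume "f dvd q"
    hence "degree f \<le> degree q" using q by (intro dvd_imp_degree_le)
    also have "\<dots> \<le> degree (pderiv f)" by (rule least[OF pd \<open>ev (pderiv f) = 0\<close>])
    finally show False using \<open>degree f \<noteq> 0\<close> by (simp add: degree_pderiv)
  next
    assume "is_unit q"
    then obtain c where "q = [:c:]" by (metis is_unit_poly_iff)
    thus False using q by (simp add: ev_def)
  qed
qed

theorem theorem9:
  fixes f :: "rat poly" and n :: nat and x :: "nat \<Rightarrow> 'a::field_char_0" and \<gamma> :: int
  assumes "lead_coeff f = 1" and "irreducible f" and "degree f = n"
    and "map_poly of_rat f = (\<Prod>j=1..n. [:- x j, 1:])"
    and "\<forall>j\<in>{1..n}. algebraic_int (of_int \<gamma> * x j)"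
  shows "\<forall>i\<in>{1..n}. \<exists>\<Delta>::int.
           of_int \<Delta> = of_int \<gamma> ^ (n * (n - 1) * nat \<lceil>real i / 2\<rceil> + tower_deg x i)
                       * root_disc n x ^ nat \<lceil>real i / 2\<rceil> \<and>
           of_int \<Delta> * tower_hat x i \<in> int_mpols i"
proof
  fix i assume "i \<in> {1..n}"
  then obtain j where i: "i = Suc j" and j: "j < n" by (cases i) auto
  have f: "map_poly of_rat f = root_poly x {1..n}" using assms(4) by (simp add: root_poly_def)
  interpret root_tower x n
  proof
    show "inj_on x {1..n}" using inj_on_roots_irreducible[OF assms(2) _ f] by simp
    show "root_poly x {1..n} \<in> poly_over \<rat>"
      unfolding f[symmetric] by (intro poly_overI) (simp add: coeff_map_poly)
  qed
  define c where "c = nat \<lceil>real i / 2\<rceil>"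
  have "c > 0" unfolding c_def i by simp
  then obtain c' where c': "c = Suc c'" by (cases c) auto
  let ?d = "tower_deg x i"
  have d: "?d > 0" using tower_deg_pos[OF j] i by simp
  show "\<exists>\<Delta>::int.
      of_int \<Delta> = of_int \<gamma> ^ (n * (n - 1) * nat \<lceil>real i / 2\<rceil> + ?d) * root_disc n x ^ nat \<lceil>real i / 2\<rceil> \<and>
      of_int \<Delta> * tower_hat x i \<in> int_mpols i"
    unfolding c_def[symmetric]
  proof (cases "\<gamma> = 0")
    \<comment> \<open>The exponent of \<gamma> is at least \<open>?d > 0\<close>, so the prescribed
      product is 0.\<close>
    case True
    thus "\<exists>\<Delta>::int. of_int \<Delta> = of_int \<gamma> ^ (n * (n - 1) * c + ?d) * root_disc n x ^ c \<and>
        of_int \<Delta> * tower_hat x i \<in> int_mpols i"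
      using d by (intro exI[of _ 0]) (simp add: int_mpols_zero)
  next
    case False
    obtain D :: int where D: "of_int D = of_int \<gamma> ^ (n * (n - 1)) * root_disc n x"
      "\<And>j k. j < n \<Longrightarrow> k \<in> tower_indices x (Suc j) \<Longrightarrow>
         of_int D * of_int \<gamma> ^ tower_deg x (Suc j) * tower_coeff x (Suc j) k \<in> \<int>"
      using tower_coeff_integral[OF False] assms(5) by blast
    show "\<exists>\<Delta>::int. of_int \<Delta> = of_int \<gamma> ^ (n * (n - 1) * c + ?d) * root_disc n x ^ c \<and>
        of_int \<Delta> * tower_hat x i \<in> int_mpols i"
    \<comment> \<open>The power \<open>D ^ c\<close> produces the prescribed exponents. One factor
      \<open>D\<close> together with \<open>\<gamma> ^ ?d\<close> clears the denominators; the other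
      \<open>c'\<close> factors are integers.\<close>
    proof (intro exI[of _ "D ^ c * \<gamma> ^ ?d"] conjI)
      have "of_int (D ^ c * \<gamma> ^ ?d) = (of_int D :: 'a) ^ c * of_int \<gamma> ^ ?d" by simp
      also have "\<dots> = of_int \<gamma> ^ (n * (n - 1) * c + ?d) * root_disc n x ^ c"
        unfolding D(1) by (simp add: power_mult_distrib power_add power_mult)
      finally show "of_int (D ^ c * \<gamma> ^ ?d) = of_int \<gamma> ^ (n * (n - 1) * c + ?d) * root_disc n x ^ c" .
      show "of_int (D ^ c * \<gamma> ^ ?d) * tower_hat x i \<in> int_mpols i"
      proof (rule scaled_tower_hat_in_int_mpols)
        fix k assume "k \<in> tower_indices x i"
        hence "of_int D * of_int \<gamma> ^ ?d * tower_coeff x i k \<in> \<int>" using D(2)[OF j] i by simp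
        hence "of_int (D ^ c') * (of_int D * of_int \<gamma> ^ ?d * tower_coeff x i k) \<in> \<int>"
          by (rule Ints_mult[OF Ints_of_int])
        thus "of_int (D ^ c * \<gamma> ^ ?d) * tower_coeff x i k \<in> \<int>"
          by (simp add: c' mult_ac)
      qed (simp add: i)
    qed
  qed
qed

end
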